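(* Let $\Xi$ be a locally finite point process on $\mathbb{R}^d\setminus\{0\}$, let $g:\mathbb{R}^d\to[0,\infty)$ be Borel measurable such that $\{g(x):x\in\Xi\}$ is locally finite, and let $\{S,S_i:i\in\mathbb{N}\}$ be i.i.d. positive random variables independent of $\Xi$. Write $\Xi=\sum_{i\in\mathcal{I}^\Xi}\delta_{X_i}$ with (possibly random) index set $\mathcal{I}^\Xi$, and let $N=\sum_{i\in\mathcal{I}^\Xi}\delta_{g(X_i)/S_i}$, as a point process on $(0,\infty)$. For $x\in\mathbb{R}^d$ let $p^{(x)}(t)=\mathbb{P}(0<g(x)/S\le t)$ and define $$M^\Xi(t)=\int_{\mathbb{R}^d}p^{(x)}(t)\,\Xi(dx).$$ Let $Z$ be the Cox process directed by the measure $M^\Xi$, that is, conditional on $\Xi$, $Z$ is a Poisson process on $(0,\infty)$ with mean measure $M^\Xi$. Then for every $\tau>0$, $$d_{\mathrm{TV}}\big(\mathcal{L}(Z|_\tau),\mathcal{L}(N|_\tau)\big)\le \mathbb{E}\int_{\mathbb{R}^d}p^{(x)}(\tau)^2\,\Xi(dx).$$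
   Context: A measure $\eta$ on $(0,\infty)$ is identified with $\eta(t):=\eta((0,t])$, and $\eta|_\tau$ denotes its restriction to $(0,\tau]$. Points equal to $0$ are disregarded in $N$. Point processes on $(0,\infty)$ are regarded as random elements of the space $\mathcal{H}$ of locally finite point measures on $(0,\infty)$, equipped with the Borel $\sigma$-algebra of the vague topology; in particular $N$ and $Z$ are regarded as random elements of $\mathcal{H}$. $\mathcal{L}(X)$ is the distribution of $X$, and $d_{\mathrm{TV}}(\nu_1,\nu_2)=\sup_A|\nu_1(A)-\nu_2(A)|$ over measurable sets $A$. *)

theory Defs
  imports "HOL-Probability.Probability"
begin

section \<open>Locally finite point measures and the vague topology\<close>

text \<open>A measure on a subset \<open>E\<close> of a topological space is a measure whose space is \<open>E\<close> with the
  trace of the Borel sigma-algebra.  In the use made of it here, \<open>E\<close> is an open subset of a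
  Euclidean space, hence locally compact, so local finiteness is finiteness on compact subsets
  of \<open>E\<close>.\<close>

definition locally_finite :: "'a::topological_space set \<Rightarrow> 'a measure \<Rightarrow> bool" where
  "locally_finite E \<eta> \<longleftrightarrow> (\<forall>K. compact K \<and> K \<subseteq> E \<longrightarrow> emeasure \<eta> K < \<infinity>)"

text \<open>The sum over \<open>i \<in> I\<close> of the Dirac measures at \<open>x i\<close>, as a measure on \<open>E\<close>: the image of
  counting measure.  Indices with \<open>x i \<notin> E\<close> are disregarded, and points are counted with
  multiplicity.\<close>

definition dirac_sum :: "'a::topological_space set \<Rightarrow> 'i set \<Rightarrow> ('i \<Rightarrow> 'a) \<Rightarrow> 'a measure" where
  "dirac_sum E I x = distr (count_space {i \<in> I. x i \<in> E}) (restrict_space borel E) x"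

lemma emeasure_dirac_sum:
  assumes "B \<in> sets borel" "B \<subseteq> E"
  shows "emeasure (dirac_sum E I x) B = emeasure (count_space I) {i \<in> I. x i \<in> B}"
proof -
  have B: "B \<in> sets (restrict_space borel E)"
    using assms by (auto simp: sets_restrict_space)
  have eq: "x -` B \<inter> {i \<in> I. x i \<in> E} = {i \<in> I. x i \<in> B}"
    using assms(2) by auto
  have "emeasure (dirac_sum E I x) B = emeasure (count_space {i \<in> I. x i \<in> E}) {i \<in> I. x i \<in> B}"
    unfolding dirac_sum_def
    by (subst emeasure_distr) (auto simp: B eq space_restrict_space)
  also have "\<dots> = emeasure (count_space I) {i \<in> I. x i \<in> B}"
    using assms(2) by (cases "finite {i \<in> I. x i \<in> B}")
      (auto simp: emeasure_count_space_finite emeasure_count_space_infinite subset_iff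
            intro!: emeasure_count_space_finite[THEN trans])
  finally show ?thesis .
qed

definition point_measures :: "'a::topological_space set \<Rightarrow> 'a measure set" where
  "point_measures E = {\<eta>. locally_finite E \<eta> \<and> (\<exists>(I :: nat set) x. \<eta> = dirac_sum E I x)}"

text \<open>The coarsest topology on the point measures making \<open>\<eta> \<mapsto> \<integral> f d\<eta>\<close> continuous for every
  continuous \<open>f\<close> with compact support in \<open>E\<close>.\<close>

definition vague_topology :: "'a::topological_space set \<Rightarrow> 'a measure topology" where
  "vague_topology E = topology_generated_by
     {{\<eta> \<in> point_measures E. (\<integral>x. f x \<partial>\<eta>) \<in> U} | (f :: 'a \<Rightarrow> real) U.
        continuous_on E f \<and> (\<exists>K. compact K \<and> K \<subseteq> E \<and> (\<forall>x\<in>E - K. f x = 0)) \<and> open U}"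

lemma topspace_vague_topology [simp]: "topspace (vague_topology E) = point_measures E"
proof -
  have "point_measures E \<in>
     {{\<eta> \<in> point_measures E. (\<integral>x. f x \<partial>\<eta>) \<in> U} | (f :: 'a \<Rightarrow> real) U.
        continuous_on E f \<and> (\<exists>K. compact K \<and> K \<subseteq> E \<and> (\<forall>x\<in>E - K. f x = 0)) \<and> open U}"
    by (intro CollectI exI[of _ "\<lambda>_. 0"] exI[of _ UNIV]) (auto intro!: exI[of _ "{}"])
  then show ?thesis
    unfolding vague_topology_def topology_generated_by_topspace by blast
qed

definition vague_borel :: "'a::topological_space set \<Rightarrow> 'a measure measure" where
  "vague_borel E = sigma (point_measures E) {U. openin (vague_topology E) U}"

lemma space_vague_borel [simp]: "space (vague_borel E) = point_measures E"
  unfolding vague_borel_def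
  by (rule space_measure_of) (use openin_subset[of "vague_topology E"] in auto)

text \<open>The restriction of a measure on \<open>(0,\<infinity>)\<close> to \<open>(0,\<tau>]\<close>, again regarded as a measure on
  \<open>(0,\<infinity>)\<close>.\<close>

definition restr :: "real \<Rightarrow> real measure \<Rightarrow> real measure" where
  "restr \<tau> \<eta> = density \<eta> (indicator {0<..\<tau>})"


section \<open>Independence\<close>

text \<open>Independence of two random elements; unlike in \<open>indep_var\<close>, their values may be of
  different types.\<close>

definition indep_elements ::
  "'w measure \<Rightarrow> 'a measure \<Rightarrow> ('w \<Rightarrow> 'a) \<Rightarrow> 'b measure \<Rightarrow> ('w \<Rightarrow> 'b) \<Rightarrow> bool" where
  "indep_elements M A X B Y \<longleftrightarrow>
     X \<in> M \<rightarrow>\<^sub>M A \<and> Y \<in> M \<rightarrow>\<^sub>M B \<and>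
     prob_space.indep_set M {X -` C \<inter> space M | C. C \<in> sets A} {Y -` D \<inter> space M | D. D \<in> sets B}"

text \<open>The family \<open>T\<close> is independent of the point process \<open>\<Xi>\<close> given with the enumeration
  \<open>(X i)\<close>, \<open>i \<in> I\<close>, of its points.  The enumeration has to be included unless it is a function of
  \<open>\<Xi>\<close>: otherwise the points could be labelled depending on \<open>T\<close>.\<close>

definition indep_of_points ::
  "'w measure \<Rightarrow> 'a::topological_space set \<Rightarrow> ('w \<Rightarrow> 'a measure) \<Rightarrow> ('w \<Rightarrow> nat set) \<Rightarrow>
   (nat \<Rightarrow> 'w \<Rightarrow> 'a) \<Rightarrow> ('k \<Rightarrow> 'w \<Rightarrow> real) \<Rightarrow> bool" where
  "indep_of_points M E \<Xi> I X T \<longleftrightarrow>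
     indep_elements M
       (vague_borel E \<Otimes>\<^sub>M (\<Pi>\<^sub>M i\<in>UNIV. count_space UNIV \<Otimes>\<^sub>M borel))
       (\<lambda>\<omega>. (\<Xi> \<omega>, \<lambda>i. (i \<in> I \<omega>, X i \<omega>)))
       (\<Pi>\<^sub>M k\<in>UNIV. borel) (\<lambda>\<omega> k. T k \<omega>)"


section \<open>Poisson and Cox processes\<close>

text \<open>\<open>P\<close> is the distribution of a Poisson process on \<open>E\<close> with mean measure \<open>\<mu>\<close>: over disjoint
  relatively compact Borel sets the counts are independent and Poisson distributed.  The Poisson
  weights are written out, as \<open>poisson_pmf\<close> excludes the rate 0.\<close>

definition poisson_process_law ::
  "'a::topological_space set \<Rightarrow> 'a measure \<Rightarrow> 'a measure measure \<Rightarrow> bool" where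
  "poisson_process_law E \<mu> P \<longleftrightarrow>
     prob_space P \<and> sets P = sets (vague_borel E) \<and> locally_finite E \<mu> \<and>
     (\<forall>(J :: nat set) B.
        finite J \<and> disjoint_family_on B J \<and>
        (\<forall>j\<in>J. B j \<in> sets borel \<and> (\<exists>K. compact K \<and> K \<subseteq> E \<and> B j \<subseteq> K)) \<longrightarrow>
        prob_space.indep_vars P (\<lambda>_. borel) (\<lambda>j \<eta>. emeasure \<eta> (B j)) J \<and>
        (\<forall>j\<in>J. \<forall>n. measure P {\<eta> \<in> space P. emeasure \<eta> (B j) = of_nat n} =
           measure \<mu> (B j) ^ n / fact n * exp (- measure \<mu> (B j))))"

text \<open>\<open>\<kappa>\<close> is a regular conditional distribution of \<open>Y\<close> (with values in \<open>B\<close>) given \<open>X\<close> (with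
  values in \<open>A\<close>).\<close>

definition cond_distribution ::
  "'w measure \<Rightarrow> 'a measure \<Rightarrow> ('w \<Rightarrow> 'a) \<Rightarrow> 'b measure \<Rightarrow> ('w \<Rightarrow> 'b) \<Rightarrow> ('a \<Rightarrow> 'b measure) \<Rightarrow> bool"
where
  "cond_distribution M A X B Y \<kappa> \<longleftrightarrow>
     \<kappa> \<in> A \<rightarrow>\<^sub>M prob_algebra B \<and>
     (\<forall>D\<in>sets A. \<forall>C\<in>sets B.
        emeasure M {\<omega> \<in> space M. X \<omega> \<in> D \<and> Y \<omega> \<in> C} =
        (\<integral>\<^sup>+\<xi>. emeasure (\<kappa> \<xi>) C * indicator D \<xi> \<partial>distr M A X))"

text \<open>\<open>Z\<close> is a Cox process on \<open>E\<close>: conditional on the point process \<open>\<Xi>\<close> on \<open>F\<close>, it is a Poisson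
  process with mean measure \<open>\<Lambda> \<Xi>\<close>.\<close>

definition cox_process ::
  "'w measure \<Rightarrow> 'b::topological_space set \<Rightarrow> ('w \<Rightarrow> 'b measure) \<Rightarrow>
   'a::topological_space set \<Rightarrow> ('b measure \<Rightarrow> 'a measure) \<Rightarrow> ('w \<Rightarrow> 'a measure) \<Rightarrow> bool" where
  "cox_process M F \<Xi> E \<Lambda> Z \<longleftrightarrow>
     \<Xi> \<in> M \<rightarrow>\<^sub>M vague_borel F \<and> Z \<in> M \<rightarrow>\<^sub>M vague_borel E \<and>
     (\<exists>\<kappa>. cond_distribution M (vague_borel F) \<Xi> (vague_borel E) Z \<kappa> \<and>
          (AE \<omega> in M. poisson_process_law E (\<Lambda> (\<Xi> \<omega>)) (\<kappa> (\<Xi> \<omega>))))"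


section \<open>The directing measure\<close>

text \<open>\<open>p_fun M S g x t\<close> is \<open>p\<^sup>(\<^sup>x\<^sup>)(t)\<close>.\<close>

definition p_fun :: "'w measure \<Rightarrow> ('w \<Rightarrow> real) \<Rightarrow> ('a \<Rightarrow> real) \<Rightarrow> 'a \<Rightarrow> real \<Rightarrow> real" where
  "p_fun M S g x t = measure M {\<omega> \<in> space M. 0 < g x / S \<omega> \<and> g x / S \<omega> \<le> t}"

text \<open>The measure \<open>M\<^sup>\<Xi>\<close> on \<open>(0,\<infinity>)\<close> for \<open>\<Xi> = \<xi>\<close>.  It is given on all Borel sets rather than only
  on the intervals \<open>(0,t]\<close>, since the values on these do not determine it if they are infinite;
  on the intervals it is \<open>\<integral> p\<^sup>(\<^sup>x\<^sup>)(t) \<xi>(dx)\<close>, see \<open>emeasure_mean_measure_interval\<close> below.\<close>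

definition mean_measure ::
  "'w measure \<Rightarrow> ('w \<Rightarrow> real) \<Rightarrow> ('a \<Rightarrow> real) \<Rightarrow> 'a measure \<Rightarrow> real measure" where
  "mean_measure M S g \<xi> =
     measure_of {0<..} (sets (restrict_space borel {0<..}))
       (\<lambda>B. \<integral>\<^sup>+x. emeasure M {\<omega> \<in> space M. g x / S \<omega> \<in> B} \<partial>\<xi>)"

lemma emeasure_mean_measure:
  fixes g :: "'a::topological_space \<Rightarrow> real"
  assumes M: "prob_space M" and S: "S \<in> borel_measurable M" and g: "g \<in> borel_measurable borel"
    and \<xi>: "sets \<xi> = sets (restrict_space borel E)"
    and B: "B \<in> sets borel" "B \<subseteq> {0<..}"
  shows "emeasure (mean_measure M S g \<xi>) B = (\<integral>\<^sup>+x. emeasure M {\<omega> \<in> space M. g x / S \<omega> \<in> B} \<partial>\<xi>)"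
proof -
  interpret prob_space M by fact
  have g': "g \<in> borel_measurable \<xi>"
    using g by (subst measurable_cong_sets[OF \<xi> refl]) (rule measurable_restrict_space1)
  have meas: "(\<lambda>x. emeasure M {\<omega> \<in> space M. g x / S \<omega> \<in> C}) \<in> borel_measurable \<xi>"
    if "C \<in> sets borel" for C
  proof -
    have "(\<lambda>z. g (fst z) / S (snd z)) \<in> borel_measurable (\<xi> \<Otimes>\<^sub>M M)"
      using g' S by measurable
    from measurable_sets[OF this that]
    have Q: "(\<lambda>z. g (fst z) / S (snd z)) -` C \<inter> space (\<xi> \<Otimes>\<^sub>M M) \<in> sets (\<xi> \<Otimes>\<^sub>M M)" .
    have "(\<lambda>x. emeasure M (Pair x -` ((\<lambda>z. g (fst z) / S (snd z)) -` C \<inter> space (\<xi> \<Otimes>\<^sub>M M))))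
            \<in> borel_measurable \<xi>"
      by (rule measurable_emeasure_Pair[OF Q])
    then show ?thesis
      by (rule measurable_cong[THEN iffD1, rotated])
        (auto simp: space_pair_measure intro!: arg_cong[where f = "emeasure M"])
  qed
  have Sev: "{\<omega> \<in> space M. g x / S \<omega> \<in> C} \<in> sets M" if "C \<in> sets borel" for x C
    using S that by measurable
  let ?R = "restrict_space borel {0::real<..}"
  have sb: "C \<in> sets borel" if "C \<in> sets ?R" for C
    using that by (auto simp: sets_restrict_space)
  show ?thesis
  proof (rule emeasure_measure_of[OF mean_measure_def])
    show "sets ?R \<subseteq> Pow {0<..}" by (auto simp: sets_restrict_space)
    show "B \<in> sets (mean_measure M S g \<xi>)"
      using B sets.sigma_sets_eq[of ?R]
      by (auto simp: mean_measure_def sets_restrict_space space_restrict_space intro!: sigma_sets.Basic)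
    show "positive (sets (mean_measure M S g \<xi>))
            (\<lambda>B. \<integral>\<^sup>+x. emeasure M {\<omega> \<in> space M. g x / S \<omega> \<in> B} \<partial>\<xi>)"
      by (auto simp: positive_def)
    have sets_eq: "sets (mean_measure M S g \<xi>) = sets ?R"
      using sets.sigma_sets_eq[of ?R] sets.space_closed[of ?R]
      by (simp add: mean_measure_def space_restrict_space)
    show "countably_additive (sets (mean_measure M S g \<xi>))
            (\<lambda>B. \<integral>\<^sup>+x. emeasure M {\<omega> \<in> space M. g x / S \<omega> \<in> B} \<partial>\<xi>)"
      unfolding sets_eq
    proof (rule countably_additiveI)
      fix A :: "nat \<Rightarrow> real set"
      assume A: "range A \<subseteq> sets ?R" "disjoint_family A"
      have Ab: "A i \<in> sets borel" for i using A(1) sb by blast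
      have "(\<Sum>i. \<integral>\<^sup>+x. emeasure M {\<omega> \<in> space M. g x / S \<omega> \<in> A i} \<partial>\<xi>) =
            (\<integral>\<^sup>+x. (\<Sum>i. emeasure M {\<omega> \<in> space M. g x / S \<omega> \<in> A i}) \<partial>\<xi>)"
        by (rule nn_integral_suminf[symmetric]) (rule meas[OF Ab])
      also have "\<dots> = (\<integral>\<^sup>+x. emeasure M {\<omega> \<in> space M. g x / S \<omega> \<in> (\<Union>i. A i)} \<partial>\<xi>)"
      proof (intro nn_integral_cong)
        fix x
        have "(\<Sum>i. emeasure M {\<omega> \<in> space M. g x / S \<omega> \<in> A i}) =
              emeasure M (\<Union>i. {\<omega> \<in> space M. g x / S \<omega> \<in> A i})"
          using A(2) Sev[OF Ab]
          by (intro suminf_emeasure) (auto simp: disjoint_family_on_def)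
        also have "(\<Union>i. {\<omega> \<in> space M. g x / S \<omega> \<in> A i}) = {\<omega> \<in> space M. g x / S \<omega> \<in> (\<Union>i. A i)}"
          by auto
        finally show "(\<Sum>i. emeasure M {\<omega> \<in> space M. g x / S \<omega> \<in> A i}) =
              emeasure M {\<omega> \<in> space M. g x / S \<omega> \<in> (\<Union>i. A i)}" .
      qed
      finally show "(\<Sum>i. \<integral>\<^sup>+x. emeasure M {\<omega> \<in> space M. g x / S \<omega> \<in> A i} \<partial>\<xi>) =
        (\<integral>\<^sup>+x. emeasure M {\<omega> \<in> space M. g x / S \<omega> \<in> (\<Union>i. A i)} \<partial>\<xi>)" .
    qed
  qed
qed

lemma emeasure_mean_measure_interval:
  fixes g :: "'a::topological_space \<Rightarrow> real"
  assumes M: "prob_space M" and S: "S \<in> borel_measurable M" and g: "g \<in> borel_measurable borel"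
    and \<xi>: "sets \<xi> = sets (restrict_space borel E)"
  shows "emeasure (mean_measure M S g \<xi>) {0<..t} = (\<integral>\<^sup>+x. ennreal (p_fun M S g x t) \<partial>\<xi>)"
proof -
  interpret prob_space M by fact
  show ?thesis
    by (subst emeasure_mean_measure[OF assms])
       (auto simp: p_fun_def emeasure_eq_measure)
qed


section \<open>Total variation distance\<close>

definition tv_dist :: "'a measure \<Rightarrow> 'a measure \<Rightarrow> real" where
  "tv_dist \<nu>1 \<nu>2 = (SUP A\<in>sets \<nu>1. \<bar>measure \<nu>1 A - measure \<nu>2 A\<bar>)"

end

theory Submission
  imports Defs
begin

text \<open>The idea is Le Cam's argument, applied after discretising the point processes, so that no Poisson
process has to be constructed and no coupling of point processes is needed.

Fix a realisation of \<open>\<Xi>\<close> with points \<open>x\<^sub>i\<close>.  Every \<open>x\<^sub>i\<close> contributes at most one point to \<open>N\<close> in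
\<open>(0,\<tau>]\<close>, which is there with probability \<open>p\<^sub>i = p\<^sup>(\<^sup>x\<^sup>)(\<tau>)\<close> for \<open>x = x\<^sub>i\<close>, and different \<open>x\<^sub>i\<close> contribute
independently; the Poisson process with mean measure \<open>M\<^sup>\<Xi>\<close> is a superposition of independent
Poisson processes, one for each \<open>x\<^sub>i\<close>, with total mass \<open>p\<^sub>i\<close> on \<open>(0,\<tau>]\<close>.  Cut \<open>(0,\<tau>]\<close> into finitely many
cells and record only the number of points in each cell.  The record of one \<open>x\<^sub>i\<close> and the record of
its Poisson counterpart differ in total variation by at most \<open>p\<^sub>i\<^sup>2\<close>: the Poisson record is empty with
probability \<open>exp (- p\<^sub>i) \<ge> 1 - p\<^sub>i\<close>, and it consists of one point in a given cell with a probability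
smaller than that of the true record by the factor \<open>exp (- p\<^sub>i)\<close>, so the true record exceeds the
Poisson one by at most \<open>p\<^sub>i (1 - exp (- p\<^sub>i)) \<le> p\<^sub>i\<^sup>2\<close> in total (\<open>tv_single_point_poisson\<close>).  Total variation is
subadditive under convolution, and a Poisson record is a convolution of Poisson records, so the
errors add up to at most \<open>\<Sum> p\<^sub>i\<^sup>2 = \<integral> p\<^sup>(\<^sup>x\<^sup>)(\<tau>)\<^sup>2 \<Xi>(dx)\<close> (\<open>tv_sum_labels_poisson\<close>).  There may be infinitely many
\<open>x\<^sub>i\<close>; the first \<open>m\<close> are treated in this way, all the others together contribute an error that
vanishes as \<open>m \<rightarrow> \<infinity>\<close> because the mean measure is finite on every cell that stays away from 0
(\<open>quenched_counts_limsup\<close>).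

Independence of \<open>\<Xi>\<close> and the \<open>S\<^sub>i\<close> lets one integrate this over the realisations of \<open>\<Xi>\<close>; the reverse
Fatou lemma moves the limit in \<open>m\<close> outside and gives the bound for all events that depend on
finitely many cell counts (\<open>count_discrepancy_le\<close>).

It remains to pass from these events to all Borel sets of the vague topology.  With dyadic cells
the events form an algebra, and this algebra generates the Borel sigma-algebra
(\<open>sets_vague_borel_count_events\<close>): each vaguely open set is a countable union of sets on which the
cell counts of some level are constant, since the integral of a continuous function of compact
support is determined up to a small error by the counts in sufficiently small cells
(\<open>integral_determined_by_dyadic_counts\<close>).  A bound on an algebra extends to the sigma-algebra that
it generates (\<open>total_variation_le_from_generating_algebra\<close>).  The cells of level \<open>n\<close> leave out
\<open>(0, \<tau> / 2\<^sup>n]\<close>, so they only see finitely many points even if \<open>N\<close> and \<open>Z\<close> accumulate at 0.\<close>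

section \<open>Total variation on a generating algebra\<close>

text \<open>Every set of the generated sigma-algebra can be approximated by sets of the algebra, for both
measures at the same time: the sets with this property are a sigma-algebra.\<close>

lemma total_variation_le_from_generating_algebra:
  assumes alg: "algebra \<Omega> \<A>"
    and P: "finite_measure P" "sets P = sigma_sets \<Omega> \<A>"
    and Q: "finite_measure Q" "sets Q = sigma_sets \<Omega> \<A>"
    and le: "\<And>A. A \<in> \<A> \<Longrightarrow> \<bar>measure P A - measure Q A\<bar> \<le> c"
    and A: "A \<in> sigma_sets \<Omega> \<A>"
  shows "\<bar>measure P A - measure Q A\<bar> \<le> c"
proof -
  interpret P: finite_measure P by fact
  interpret Q: finite_measure Q by fact
  interpret alg: algebra \<Omega> \<A> by fact
  have [simp]: "A \<in> sets P" "A \<in> sets Q" if "A \<in> sigma_sets \<Omega> \<A>" for A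
    using P Q that by auto
  have [simp]: "A \<in> sets P" "A \<in> sets Q" if "A \<in> \<A>" for A
    using P Q that by auto
  define d where "d A B = measure P (A - B \<union> (B - A)) + measure Q (A - B \<union> (B - A))" for A B
  have approx: "\<exists>B\<in>\<A>. d A B < e" if "A \<in> sigma_sets \<Omega> \<A>" "0 < e" for A e
    using that
  proof (induction arbitrary: e rule: sigma_sets.induct)
    case (Basic A)
    then show ?case by (intro bexI[of _ A]) (auto simp: d_def)
  next
    case Empty
    then show ?case by (intro bexI[of _ "{}"]) (auto simp: d_def)
  next
    case (Compl A)
    then obtain B where B: "B \<in> \<A>" "d A B < e" by blast
    have "A \<subseteq> \<Omega>" "B \<subseteq> \<Omega>"
      using Compl.hyps B(1) alg.space_closed sigma_sets_into_sp[OF alg.space_closed] by auto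
    then have "d (\<Omega> - A) (\<Omega> - B) = d A B"
      unfolding d_def by (intro arg_cong2[of _ _ _ _ "(+)"] arg_cong[of _ _ "measure _"]) auto
    then show ?case using B by (intro bexI[of _ "\<Omega> - B"]) auto
  next
    case (Union A)
    let ?U = "\<Union>i. A i" and ?V = "\<lambda>n. \<Union>i<n. A i"
    have V: "?V n \<in> sigma_sets \<Omega> \<A>" for n
      using Union.hyps P(2) sets.finite_UN[of "{..<n}" A P] by auto
    have U: "?U \<in> sigma_sets \<Omega> \<A>" using Union.hyps by (rule sigma_sets.Union)
    have UV: "(\<Union>n. ?V n) = ?U" by auto
    have inc: "incseq ?V" by (intro monoI UN_mono) auto
    have "(\<lambda>n. measure P (?V n)) \<longlonglongrightarrow> measure P ?U"
      using P.finite_Lim_measure_incseq[of ?V] V inc UV by (auto simp: image_subset_iff)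
    moreover have "(\<lambda>n. measure Q (?V n)) \<longlonglongrightarrow> measure Q ?U"
      using Q.finite_Lim_measure_incseq[of ?V] V inc UV by (auto simp: image_subset_iff)
    ultimately have "(\<lambda>n. measure P (?V n) + measure Q (?V n)) \<longlonglongrightarrow> measure P ?U + measure Q ?U"
      by (rule tendsto_add)
    then have "\<forall>\<^sub>F n in sequentially. measure P ?U + measure Q ?U - e / 2 < measure P (?V n) + measure Q (?V n)"
      using Union.prems by (intro order_tendstoD) auto
    then obtain n where n: "measure P ?U + measure Q ?U - e / 2 < measure P (?V n) + measure Q (?V n)"
      by (auto dest: eventually_happens)
    have diff: "measure P (?U - ?V n) + measure Q (?U - ?V n) < e / 2"
    proof -
      have "?V n \<subseteq> ?U" by auto
      then have "measure P (?U - ?V n) = measure P ?U - measure P (?V n)"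
        "measure Q (?U - ?V n) = measure Q ?U - measure Q (?V n)"
        using U V by (auto intro!: P.finite_measure_Diff Q.finite_measure_Diff)
      then show ?thesis using n by simp
    qed
    \<comment> \<open>One half of \<open>e\<close> is spent on the tail of the union, the other half is divided among its first
      \<open>n\<close> members; the \<open>+ 1\<close> covers \<open>n = 0\<close>.\<close>
    define e' where "e' = e / (2 * (real n + 1))"
    have e': "0 < e'" "real n * e' < e / 2"
      using Union.prems by (auto simp: e'_def field_simps)
    have "\<forall>i. \<exists>B\<in>\<A>. d (A i) B < e'" using Union.IH e' by blast
    then obtain B where B: "\<And>i. B i \<in> \<A>" "\<And>i. d (A i) (B i) < e'" by metis
    let ?B = "\<Union>i<n. B i" and ?D = "\<lambda>i. A i - B i \<union> (B i - A i)"
    have BA: "?B \<in> \<A>" using B by auto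
    have D: "?D i \<in> sets P" "?D i \<in> sets Q" for i
      using B(1)[of i] Union.hyps[of i] by (auto intro!: sets.Un sets.Diff)
    have meas: "?U \<in> sets P" "?U \<in> sets Q" "?V n \<in> sets P" "?V n \<in> sets Q" "?B \<in> sets P" "?B \<in> sets Q"
      "(\<Union>i<n. ?D i) \<in> sets P" "(\<Union>i<n. ?D i) \<in> sets Q"
      using U V[of n] BA D by (auto intro!: sets.finite_UN)
    have sub: "?U - ?B \<union> (?B - ?U) \<subseteq> (?U - ?V n) \<union> (\<Union>i<n. ?D i)" by blast
    have mP: "measure P (?U - ?B \<union> (?B - ?U)) \<le> measure P (?U - ?V n) + (\<Sum>i<n. measure P (?D i))"
    proof -
      have "measure P (?U - ?B \<union> (?B - ?U)) \<le> measure P ((?U - ?V n) \<union> (\<Union>i<n. ?D i))"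
        using meas D by (intro P.finite_measure_mono sub) auto
      also have "\<dots> \<le> measure P (?U - ?V n) + measure P (\<Union>i<n. ?D i)"
        using meas D by (intro measure_Un_le) auto
      also have "measure P (\<Union>i<n. ?D i) \<le> (\<Sum>i<n. measure P (?D i))"
        using D by (intro P.finite_measure_subadditive_finite) auto
      finally show ?thesis by simp
    qed
    have mQ: "measure Q (?U - ?B \<union> (?B - ?U)) \<le> measure Q (?U - ?V n) + (\<Sum>i<n. measure Q (?D i))"
    proof -
      have "measure Q (?U - ?B \<union> (?B - ?U)) \<le> measure Q ((?U - ?V n) \<union> (\<Union>i<n. ?D i))"
        using meas D by (intro Q.finite_measure_mono sub) auto
      also have "\<dots> \<le> measure Q (?U - ?V n) + measure Q (\<Union>i<n. ?D i)"
        using meas D by (intro measure_Un_le) auto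
      also have "measure Q (\<Union>i<n. ?D i) \<le> (\<Sum>i<n. measure Q (?D i))"
        using D by (intro Q.finite_measure_subadditive_finite) auto
      finally show ?thesis by simp
    qed
    have "d ?U ?B \<le> measure P (?U - ?V n) + measure Q (?U - ?V n) + (\<Sum>i<n. d (A i) (B i))"
      using mP mQ by (simp add: d_def sum.distrib)
    also have "(\<Sum>i<n. d (A i) (B i)) \<le> real n * e'"
      using sum_bounded_above[of "{..<n}" "\<lambda>i. d (A i) (B i)" e'] B(2) by (simp add: less_imp_le)
    finally have "d ?U ?B < e" using diff e' by simp
    with BA show ?case by blast
  qed
  \<comment> \<open>Sets with a small symmetric difference have almost the same measure.\<close>
  have one: "\<bar>measure R A - measure R B\<bar> \<le> measure R (A - B \<union> (B - A))"
    if "finite_measure R" "A \<in> sets R" "B \<in> sets R" for R :: "'a measure" and A B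
  proof -
    interpret R: finite_measure R by fact
    have "measure R A \<le> measure R (B \<union> (A - B \<union> (B - A)))"
      using that by (intro R.finite_measure_mono) auto
    also have "\<dots> \<le> measure R B + measure R (A - B \<union> (B - A))"
      using that by (intro measure_Un_le) auto
    finally have 1: "measure R A - measure R B \<le> measure R (A - B \<union> (B - A))" by simp
    have "measure R B \<le> measure R (A \<union> (A - B \<union> (B - A)))"
      using that by (intro R.finite_measure_mono) auto
    also have "\<dots> \<le> measure R A + measure R (A - B \<union> (B - A))"
      using that by (intro measure_Un_le) auto
    finally show ?thesis using 1 by simp
  qed
  show ?thesis
  proof (rule field_le_epsilon)
    fix e :: real assume "0 < e"
    with A obtain B where B: "B \<in> \<A>" "d A B < e" using approx by blast
    have "\<bar>measure P A - measure P B\<bar> + \<bar>measure Q A - measure Q B\<bar> \<le> d A B"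
      unfolding d_def using A B P Q by (intro add_mono one) auto
    with le[OF B(1)] B(2) show "\<bar>measure P A - measure Q A\<bar> \<le> c + e" by linarith
  qed
qed

section \<open>Le Cam's inequality for finite configurations\<close>

definition conv_pmf :: "'a::comm_monoid_add pmf \<Rightarrow> 'a pmf \<Rightarrow> 'a pmf" where
  "conv_pmf p q = bind_pmf p (\<lambda>x. map_pmf (\<lambda>y. x + y) q)"

lemma conv_pmf_commute: "conv_pmf p q = conv_pmf q p"
  unfolding conv_pmf_def map_pmf_def
  by (subst bind_commute_pmf) (simp add: add.commute)

lemma conv_pmf_return_0 [simp]: "conv_pmf p (return_pmf 0) = p"
  unfolding conv_pmf_def by (simp add: bind_return_pmf')

lemma measure_bind_pmf:
  "measure (bind_pmf p f) C = (\<integral>x. measure (f x) C \<partial>measure_pmf p)"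
proof -
  have "ennreal (measure (bind_pmf p f) C) = (\<integral>\<^sup>+x. ennreal (measure (f x) C) \<partial>measure_pmf p)"
    using emeasure_bind_pmf[of p f C] by (simp only: measure_pmf.emeasure_eq_measure)
  also have "\<dots> = ennreal (\<integral>x. measure (f x) C \<partial>measure_pmf p)"
    by (intro nn_integral_eq_integral measure_pmf.integrable_const_bound[where B=1])
       (auto intro!: AE_pmfI simp: measure_pmf.prob_le_1)
  finally show ?thesis by (simp add: integral_nonneg_AE)
qed

definition tv_le :: "real \<Rightarrow> 'a pmf \<Rightarrow> 'a pmf \<Rightarrow> bool" where
  "tv_le c p q \<longleftrightarrow> (\<forall>C. \<bar>measure p C - measure q C\<bar> \<le> c)"

lemma tv_le_trans: "tv_le c p q \<Longrightarrow> tv_le d q r \<Longrightarrow> tv_le (c + d) p r"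
  unfolding tv_le_def by (intro allI abs_leI; smt (verit, ccfv_threshold))

text \<open>Conditioning on the first summand, the two laws are the translates of \<open>q\<close> and \<open>q'\<close> by the same
amount.\<close>

lemma tv_le_conv_right:
  fixes p q q' :: "'a::comm_monoid_add pmf"
  assumes "tv_le c q q'"
  shows "tv_le c (conv_pmf p q) (conv_pmf p q')"
  unfolding tv_le_def
proof
  fix C :: "'a set"
  let ?f = "\<lambda>(q :: 'a pmf) x. measure (map_pmf ((+) x) q) C"
  have int: "integrable (measure_pmf p) (?f q)" for q
    by (intro measure_pmf.integrable_const_bound[where B=1]) (auto intro!: AE_pmfI simp: measure_pmf.prob_le_1)
  have "measure (conv_pmf p q) C - measure (conv_pmf p q') C = (\<integral>x. ?f q x - ?f q' x \<partial>measure_pmf p)"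
    unfolding conv_pmf_def measure_bind_pmf using int by (simp add: Bochner_Integration.integral_diff)
  also have "\<bar>\<dots>\<bar> \<le> (\<integral>x. \<bar>?f q x - ?f q' x\<bar> \<partial>measure_pmf p)"
    by (rule integral_abs_bound)
  also have "\<dots> \<le> (\<integral>x. c \<partial>measure_pmf p)"
    using int assms by (intro integral_mono) (auto simp: tv_le_def)
  finally show "\<bar>measure (conv_pmf p q) C - measure (conv_pmf p q') C\<bar> \<le> c" by simp
qed

lemma tv_le_conv:
  assumes "tv_le c p p'" "tv_le d q q'"
  shows "tv_le (c + d) (conv_pmf p q) (conv_pmf p' q')"
proof (rule tv_le_trans)
  show "tv_le c (conv_pmf p q) (conv_pmf p' q)"
    using tv_le_conv_right[OF assms(1), of q] by (simp add: conv_pmf_commute[of _ q])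
  show "tv_le d (conv_pmf p' q) (conv_pmf p' q')"
    by (rule tv_le_conv_right[OF assms(2)])
qed

text \<open>Both probabilities have total mass 1, so it is enough to bound the amount by which \<open>p\<close> exceeds
\<open>q\<close>, and this only requires looking at the atoms of \<open>p\<close>.\<close>

lemma tv_le_from_pointwise:
  assumes F: "finite F" "set_pmf p \<subseteq> F" and e: "\<And>x. x \<in> F \<Longrightarrow> 0 \<le> e x \<and> pmf p x \<le> pmf q x + e x"
  shows "tv_le (sum e F) p q"
proof -
  have le: "measure p C - measure q C \<le> sum e F" for C
  proof -
    have "measure p C = measure p (C \<inter> F)"
      using F(2) by (intro measure_pmf.finite_measure_eq_AE) (auto intro!: AE_pmfI)
    also have "\<dots> = (\<Sum>x\<in>C \<inter> F. pmf p x)" using F by (simp add: measure_measure_pmf_finite)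
    also have "\<dots> \<le> (\<Sum>x\<in>C \<inter> F. pmf q x + e x)" using e by (intro sum_mono) auto
    also have "\<dots> = measure q (C \<inter> F) + sum e (C \<inter> F)"
      using F by (simp add: sum.distrib measure_measure_pmf_finite)
    also have "measure q (C \<inter> F) \<le> measure q C" by (intro measure_pmf.finite_measure_mono) auto
    also have "sum e (C \<inter> F) \<le> sum e F" using F e by (intro sum_mono2) auto
    finally show ?thesis by simp
  qed
  have compl: "measure r (- C) = 1 - measure r C" for r :: "'a pmf" and C
    using measure_pmf.prob_compl[of C r] by (simp add: Compl_eq_Diff_UNIV)
  show ?thesis unfolding tv_le_def
  proof
    fix C show "\<bar>measure p C - measure q C\<bar> \<le> sum e F"
      using le[of C] le[of "- C"] unfolding compl by linarith
  qed
qed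

text \<open>The Poisson distribution including the degenerate rate 0, which occurs for cells that are not
charged by the mean measure.\<close>

definition poisson0 :: "real \<Rightarrow> nat pmf" where
  "poisson0 r = (if r > 0 then poisson_pmf r else return_pmf 0)"

lemma pmf_poisson0: "0 \<le> r \<Longrightarrow> pmf (poisson0 r) n = r ^ n / fact n * exp (- r)"
  by (cases n) (auto simp: poisson0_def indicator_def)

lemma poisson0_add:
  assumes "0 \<le> a" "0 \<le> b"
  shows "conv_pmf (poisson0 a) (poisson0 b) = poisson0 (a + b)"
proof (rule pmf_eqI)
  fix n
  have "pmf (conv_pmf (poisson0 a) (poisson0 b)) n =
      (\<integral>x. pmf (map_pmf ((+) x) (poisson0 b)) n \<partial>measure_pmf (poisson0 a))"
    unfolding conv_pmf_def pmf_bind ..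
  also have "\<dots> = (\<integral>x. (if x \<le> n then pmf (poisson0 b) (n - x) else 0) \<partial>measure_pmf (poisson0 a))"
  proof (intro Bochner_Integration.integral_cong refl)
    fix x
    have "(+) x -` {n} = (if x \<le> n then {n - x} else {})" by auto
    then show "pmf (map_pmf ((+) x) (poisson0 b)) n = (if x \<le> n then pmf (poisson0 b) (n - x) else 0)"
      by (simp add: pmf_map measure_pmf_single)
  qed
  also have "\<dots> = (\<Sum>x\<le>n. pmf (poisson0 b) (n - x) * pmf (poisson0 a) x)"
    by (subst integral_measure_pmf_real[where A="{..n}"]) (auto split: if_splits)
  also have "\<dots> = (\<Sum>x\<le>n. exp (- (a + b)) / fact n * (real (n choose x) * a ^ x * b ^ (n - x)))"
    using assms
    by (intro sum.cong refl) (simp add: pmf_poisson0 binomial_fact exp_add[symmetric] exp_minus field_simps exp_diff)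
  also have "\<dots> = pmf (poisson0 (a + b)) n"
    using assms by (subst pmf_poisson0) (auto simp: binomial_ring sum_distrib_left sum_distrib_right sum_divide_distrib mult_ac)
  finally show "pmf (conv_pmf (poisson0 a) (poisson0 b)) n = pmf (poisson0 (a + b)) n" .
qed

text \<open>A configuration of points in the cells \<open>k \<in> J\<close> is stored as the multiset in which \<open>k\<close> occurs as
often as the cell has points.  Superposition is then addition, and there are only countably many
configurations, so their laws are probability mass functions.\<close>

definition config :: "'k set \<Rightarrow> ('k \<Rightarrow> nat) \<Rightarrow> 'k multiset" where
  "config J f = (\<Sum>k\<in>J. replicate_mset (f k) k)"

lemma count_config: "finite J \<Longrightarrow> count (config J f) k = (if k \<in> J then f k else 0)"
  unfolding config_def count_sum by (simp add: if_distrib cong: if_cong)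

lemma set_mset_config: "finite J \<Longrightarrow> set_mset (config J f) \<subseteq> J"
  by (auto simp: count_config simp flip: count_greater_zero_iff split: if_splits)

lemma config_eq_iff:
  "finite J \<Longrightarrow> config J f = m \<longleftrightarrow> set_mset m \<subseteq> J \<and> (\<forall>k\<in>J. f k = count m k)"
  by (auto simp: multiset_eq_iff count_config count_eq_zero_iff
           dest: set_mset_config[THEN subsetD])

definition poisson_config :: "'k set \<Rightarrow> ('k \<Rightarrow> real) \<Rightarrow> 'k multiset pmf" where
  "poisson_config J r = map_pmf (config J) (Pi_pmf J 0 (\<lambda>k. poisson0 (r k)))"

lemma pmf_poisson_config:
  assumes "finite J"
  shows "pmf (poisson_config J r) m =
     (if set_mset m \<subseteq> J then \<Prod>k\<in>J. pmf (poisson0 (r k)) (count m k) else 0)"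
proof (cases "set_mset m \<subseteq> J")
  case True
  let ?P = "Pi_pmf J 0 (\<lambda>k. poisson0 (r k))"
  have "pmf (poisson_config J r) m = measure ?P {f. config J f = m}"
    by (simp add: poisson_config_def pmf_map vimage_def)
  also have "\<dots> = measure ?P {count m}"
  proof (intro measure_pmf.finite_measure_eq_AE AE_pmfI)
    fix f assume "f \<in> set_pmf ?P"
    then have "k \<notin> J \<Longrightarrow> f k = 0" for k using set_Pi_pmf_subset[OF assms] by fastforce
    moreover have "k \<notin> J \<Longrightarrow> count m k = 0" for k using True by (auto simp: count_eq_zero_iff)
    ultimately have "config J f = m \<longleftrightarrow> f = count m"
      using True by (auto simp: config_eq_iff[OF assms] fun_eq_iff; metis)
    then show "f \<in> {f. config J f = m} \<longleftrightarrow> f \<in> {count m}" by simp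
  qed auto
  also have "\<dots> = (\<Prod>k\<in>J. pmf (poisson0 (r k)) (count m k))"
    unfolding measure_pmf_single using assms True by (subst pmf_Pi') (auto simp: count_eq_zero_iff)
  finally show ?thesis using True by simp
next
  case False
  then have "(\<lambda>f. config J f) -` {m} = {}" using set_mset_config[OF assms] by auto
  with False show ?thesis by (simp add: poisson_config_def pmf_map)
qed

text \<open>The superposition property of Poisson processes, at the level of cell counts.\<close>

lemma poisson_config_add:
  assumes J: "finite J" and "\<And>k. k \<in> J \<Longrightarrow> 0 \<le> a k" "\<And>k. k \<in> J \<Longrightarrow> 0 \<le> b k"
  shows "conv_pmf (poisson_config J a) (poisson_config J b) = poisson_config J (\<lambda>k. a k + b k)"
proof -
  let ?P = "\<lambda>a. Pi_pmf J 0 (\<lambda>k. poisson0 (a k))"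
  have add: "config J (\<lambda>k. f k + g k) = config J f + config J g" for f g
    using J by (intro multiset_eqI) (simp add: count_config)
  have "?P (\<lambda>k. a k + b k) = Pi_pmf J 0 (\<lambda>k. bind_pmf (poisson0 (a k)) (\<lambda>x. map_pmf (\<lambda>y. x + y) (poisson0 (b k))))"
    using assms by (intro Pi_pmf_cong) (auto simp: poisson0_add[symmetric] conv_pmf_def)
  also have "\<dots> = bind_pmf (?P a) (\<lambda>f. Pi_pmf J 0 (\<lambda>k. bind_pmf (poisson0 (b k)) (\<lambda>y. return_pmf (f k + y))))"
    using J by (simp add: Pi_pmf_bind[where d'=0] map_pmf_def)
  also have "\<dots> = bind_pmf (?P a) (\<lambda>f. bind_pmf (?P b) (\<lambda>g. return_pmf (\<lambda>k. if k \<in> J then f k + g k else 0)))"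
    using J by (subst Pi_pmf_bind[where d'=0]) auto
  finally have eq: "?P (\<lambda>k. a k + b k) = \<dots>" .
  have if_J: "config J (\<lambda>k. if k \<in> J then h k else 0) = config J h" for h
    by (simp add: config_def)
  show ?thesis
    unfolding poisson_config_def eq conv_pmf_def map_pmf_def
    by (simp add: bind_assoc_pmf bind_return_pmf if_J add)
qed

lemma pmf_poisson_config_empty:
  assumes "finite J" "\<And>k. k \<in> J \<Longrightarrow> 0 \<le> r k"
  shows "pmf (poisson_config J r) {#} = exp (- sum r J)"
  using assms by (simp add: pmf_poisson_config pmf_poisson0 exp_sum sum_negf[symmetric])

lemma pmf_poisson_config_single:
  assumes J: "finite J" "\<And>k. k \<in> J \<Longrightarrow> 0 \<le> r k" and j: "j \<in> J"
  shows "pmf (poisson_config J r) {#j#} = r j * exp (- sum r J)"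
proof -
  have "pmf (poisson_config J r) {#j#} = (\<Prod>k\<in>J. (if k = j then r k else 1) * exp (- r k))"
    using assms by (auto simp: pmf_poisson_config pmf_poisson0 intro!: prod.cong)
  also have "\<dots> = r j * exp (- sum r J)"
    using J j by (simp add: prod.distrib exp_sum sum_negf[symmetric])
  finally show ?thesis .
qed

text \<open>Le Cam's estimate for one point that falls into cell \<open>k\<close> with probability \<open>pmf b {#k#}\<close> and is absent
otherwise.  With \<open>p\<close> the probability of being present, \<open>b\<close> exceeds the Poisson law only at the
singletons, by \<open>pmf b {#k#} * (1 - exp (- p)) \<le> pmf b {#k#} * p\<close>; the sum over \<open>k\<close> is at most \<open>p\<^sup>2\<close>.\<close>

lemma tv_single_point_poisson:
  assumes J: "finite J" and b: "set_pmf b \<subseteq> insert {#} ((\<lambda>k. {#k#}) ` J)"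
  shows "tv_le ((\<Sum>k\<in>J. pmf b {#k#})\<^sup>2) b (poisson_config J (\<lambda>k. pmf b {#k#}))"
proof -
  let ?l = "\<lambda>k. pmf b {#k#}" and ?s = "\<lambda>k. {#k#}"
  define p where "p = sum ?l J"
  have inj: "inj_on ?s J" by (auto simp: inj_on_def)
  have "1 = sum (pmf b) (insert {#} (?s ` J))"
    using sum_pmf_eq_1[OF _ b] J by simp
  also have "\<dots> = pmf b {#} + p"
    using J by (subst sum.insert) (auto simp: p_def sum.reindex[OF inj])
  finally have b0: "pmf b {#} = 1 - p" by simp
  have p: "0 \<le> p" unfolding p_def by (intro sum_nonneg) simp
  have ex: "1 - p \<le> exp (- p)" using exp_ge_add_one_self[of "- p"] by simp
  define e where "e m = (if m = {#} then 0 else pmf b m * p)" for m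
  have "tv_le (sum e (insert {#} (?s ` J))) b (poisson_config J ?l)"
  proof (rule tv_le_from_pointwise[OF _ b])
    fix m assume "m \<in> insert {#} (?s ` J)"
    then show "0 \<le> e m \<and> pmf b m \<le> pmf (poisson_config J ?l) m + e m"
    proof (elim insertE imageE)
      assume "m = {#}"
      then show ?thesis using ex by (simp add: e_def b0 pmf_poisson_config_empty J p_def)
    next
      fix k assume k: "m = {#k#}" "k \<in> J"
      have "?l k * (1 - p) \<le> ?l k * exp (- p)" using ex by (intro mult_left_mono) auto
      then show ?thesis using k p J
        by (simp add: e_def pmf_poisson_config_single p_def[symmetric] algebra_simps)
    qed
  qed (use J in auto)
  also have "sum e (insert {#} (?s ` J)) = p\<^sup>2"
    using J by (subst sum.insert)
      (auto simp: e_def sum.reindex[OF inj] p_def sum_distrib_right[symmetric] power2_eq_square)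
  finally show ?thesis by (simp add: p_def)
qed

text \<open>A Poisson configuration of small intensity is empty with probability close to 1.  This disposes of
the points that a finite truncation leaves out.\<close>

lemma tv_empty_poisson:
  assumes J: "finite J" "\<And>k. k \<in> J \<Longrightarrow> 0 \<le> r k"
  shows "tv_le (sum r J) (return_pmf {#}) (poisson_config J r)"
proof -
  have "tv_le (sum (\<lambda>_. sum r J) {{#} :: 'a multiset}) (return_pmf {#}) (poisson_config J r)"
  proof (rule tv_le_from_pointwise[where F = "{{#} :: 'a multiset}" and e = "\<lambda>_. sum r J"])
    show "0 \<le> sum r J \<and> pmf (return_pmf {#}) m \<le> pmf (poisson_config J r) m + sum r J"
      if "m \<in> {{#}}" for m
      using that assms exp_ge_add_one_self[of "- sum r J"]
      by (auto simp: pmf_poisson_config_empty intro!: sum_nonneg)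
  qed auto
  then show ?thesis by simp
qed

section \<open>Sums of independent random configurations\<close>

instance multiset :: (countable) countable
proof
  show "\<exists>to_nat :: 'a multiset \<Rightarrow> nat. inj to_nat"
    by (rule exI[of _ "\<lambda>m. to_nat (SOME xs. mset xs = m)"])
       (metis (mono_tags, lifting) ex_mset from_nat_to_nat injI someI_ex)
qed

text \<open>The law of a discrete random variable as a probability mass function, which gives access to
\<open>bind_pmf\<close> and pointwise comparison.\<close>

definition rv_pmf :: "'w measure \<Rightarrow> ('w \<Rightarrow> 'a) \<Rightarrow> 'a pmf" where
  "rv_pmf M W = Abs_pmf (distr M (count_space UNIV) W)"

lemma measure_pmf_rv_pmf:
  fixes W :: "'w \<Rightarrow> 'a::countable"
  assumes M: "prob_space M" and W: "W \<in> M \<rightarrow>\<^sub>M count_space UNIV"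
  shows "measure_pmf (rv_pmf M W) = distr M (count_space UNIV) W"
  unfolding rv_pmf_def
proof (rule Abs_pmf_inverse, intro CollectI conjI)
  let ?D = "distr M (count_space UNIV) W"
  interpret D: prob_space ?D by (rule prob_space.prob_space_distr[OF M W])
  show "prob_space ?D" by unfold_locales
  show "sets ?D = UNIV" by simp
  have "(\<Union>x\<in>{x. D.prob {x} = 0}. {x}) \<in> null_sets ?D"
    by (intro null_sets_UN') (auto simp: null_sets_def D.emeasure_eq_measure)
  then show "AE x in ?D. D.prob {x} \<noteq> 0"
    by (rule AE_I') auto
qed

lemma measure_rv_pmf:
  fixes W :: "'w \<Rightarrow> 'a::countable"
  assumes "prob_space M" "W \<in> M \<rightarrow>\<^sub>M count_space UNIV"
  shows "measure (rv_pmf M W) C = measure M {\<omega> \<in> space M. W \<omega> \<in> C}"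
  unfolding measure_pmf_rv_pmf[OF assms]
  using assms(2) by (subst measure_distr) (auto intro!: arg_cong[where f = "measure M"])

lemma pmf_rv_pmf:
  fixes W :: "'w \<Rightarrow> 'a::countable"
  assumes "prob_space M" "W \<in> M \<rightarrow>\<^sub>M count_space UNIV"
  shows "pmf (rv_pmf M W) x = measure M {\<omega> \<in> space M. W \<omega> = x}"
  using measure_rv_pmf[OF assms, of "{x}"] by (simp add: measure_pmf_single)

lemma set_rv_pmf:
  fixes W :: "'w \<Rightarrow> 'a::countable"
  assumes "prob_space M" "W \<in> M \<rightarrow>\<^sub>M count_space UNIV"
  shows "set_pmf (rv_pmf M W) \<subseteq> W ` space M"
proof
  fix x assume "x \<in> set_pmf (rv_pmf M W)"
  then have "measure M {\<omega> \<in> space M. W \<omega> = x} \<noteq> 0"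
    by (simp add: set_pmf_iff pmf_rv_pmf[OF assms])
  then have "{\<omega> \<in> space M. W \<omega> = x} \<noteq> {}" by (metis measure_empty)
  then show "x \<in> W ` space M" by auto
qed

lemma measurable_add_count_space [measurable (raw)]:
  fixes U W :: "'w \<Rightarrow> 'a::{countable, plus}"
  assumes U: "U \<in> M \<rightarrow>\<^sub>M count_space UNIV" and W: "W \<in> M \<rightarrow>\<^sub>M count_space UNIV"
  shows "(\<lambda>\<omega>. U \<omega> + W \<omega>) \<in> M \<rightarrow>\<^sub>M count_space UNIV"
proof (rule measurable_compose_countable[OF _ U])
  fix u show "(\<lambda>\<omega>. u + W \<omega>) \<in> M \<rightarrow>\<^sub>M count_space UNIV"
    using W by (rule measurable_compose) simp
qed

lemma measurable_sum_count_space: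
  fixes W :: "'i \<Rightarrow> 'w \<Rightarrow> 'a::{countable, comm_monoid_add}"
  assumes "\<And>i. i \<in> I \<Longrightarrow> W i \<in> M \<rightarrow>\<^sub>M count_space UNIV"
  shows "(\<lambda>\<omega>. \<Sum>i\<in>I. W i \<omega>) \<in> M \<rightarrow>\<^sub>M count_space UNIV"
  using assms
  by (induction I rule: infinite_finite_induct) (auto intro!: measurable_add_count_space)

lemma rv_pmf_add:
  fixes U W :: "'w \<Rightarrow> 'a::{countable, comm_monoid_add}"
  assumes M: "prob_space M"
    and ind: "prob_space.indep_var M (count_space UNIV) U (count_space UNIV) W"
  shows "rv_pmf M (\<lambda>\<omega>. U \<omega> + W \<omega>) = conv_pmf (rv_pmf M U) (rv_pmf M W)"
proof (rule pmf_eqI)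
  interpret prob_space M by fact
  fix x
  have U: "U \<in> M \<rightarrow>\<^sub>M count_space UNIV" and W: "W \<in> M \<rightarrow>\<^sub>M count_space UNIV"
    using ind by (auto dest: indep_var_rv1 indep_var_rv2)
  note [measurable] = U W
  have "ennreal (pmf (rv_pmf M (\<lambda>\<omega>. U \<omega> + W \<omega>)) x) = emeasure M {\<omega> \<in> space M. U \<omega> + W \<omega> = x}"
    by (subst pmf_rv_pmf[OF M]) (auto simp: emeasure_eq_measure intro!: measurable_add_count_space)
  also have "{\<omega> \<in> space M. U \<omega> + W \<omega> = x} = (\<Union>u. {\<omega> \<in> space M. U \<omega> = u \<and> u + W \<omega> = x})" by auto
  also have "emeasure M \<dots> = (\<integral>\<^sup>+u. emeasure M {\<omega> \<in> space M. U \<omega> = u \<and> u + W \<omega> = x} \<partial>count_space UNIV)"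
    by (subst emeasure_UN_countable) (auto simp: disjoint_family_on_def)
  also have "\<dots> = (\<integral>\<^sup>+u. ennreal (pmf (rv_pmf M U) u) * ennreal (pmf (map_pmf (\<lambda>y. u + y) (rv_pmf M W)) x) \<partial>count_space UNIV)"
  proof (intro nn_integral_cong)
    fix u
    have "emeasure M {\<omega> \<in> space M. U \<omega> = u \<and> u + W \<omega> = x} =
        prob ((\<lambda>\<omega>. (U \<omega>, W \<omega>)) -` ({u} \<times> {y. u + y = x}) \<inter> space M)"
      by (auto simp: emeasure_eq_measure intro!: arg_cong[where f = prob])
    also have "\<dots> = prob (U -` {u} \<inter> space M) * prob (W -` {y. u + y = x} \<inter> space M)"
      by (subst indep_varD[OF ind]) auto
    also have "prob (U -` {u} \<inter> space M) = pmf (rv_pmf M U) u"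
      by (subst pmf_rv_pmf[OF M U]) (auto intro!: arg_cong[where f = prob])
    also have "prob (W -` {y. u + y = x} \<inter> space M) = pmf (map_pmf (\<lambda>y. u + y) (rv_pmf M W)) x"
      unfolding pmf_map by (subst measure_rv_pmf[OF M W]) (auto intro!: arg_cong[where f = prob])
    finally show "emeasure M {\<omega> \<in> space M. U \<omega> = u \<and> u + W \<omega> = x} =
       ennreal (pmf (rv_pmf M U) u) * ennreal (pmf (map_pmf (\<lambda>y. u + y) (rv_pmf M W)) x)"
      by (simp add: ennreal_mult)
  qed
  also have "\<dots> = (\<integral>\<^sup>+u. ennreal (pmf (map_pmf (\<lambda>y. u + y) (rv_pmf M W)) x) \<partial>measure_pmf (rv_pmf M U))"
    by (simp add: nn_integral_measure_pmf)
  also have "\<dots> = ennreal (pmf (conv_pmf (rv_pmf M U) (rv_pmf M W)) x)"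
    unfolding conv_pmf_def ennreal_pmf_bind ..
  finally show "pmf (rv_pmf M (\<lambda>\<omega>. U \<omega> + W \<omega>)) x = pmf (conv_pmf (rv_pmf M U) (rv_pmf M W)) x"
    by simp
qed

text \<open>Induction over the points: one more independent point convolves the law of the configuration with
the law of that point, and one more Poisson configuration is convolved on the other side.\<close>

lemma tv_sum_labels_poisson:
  fixes W :: "nat \<Rightarrow> 'w \<Rightarrow> 'k::countable multiset"
  assumes M: "prob_space M" and J: "finite J"
    and ind: "prob_space.indep_vars M (\<lambda>_. count_space UNIV) W UNIV"
    and W: "\<And>i \<omega>. W i \<omega> \<in> insert {#} ((\<lambda>k. {#k#}) ` J)"
  defines "r \<equiv> \<lambda>i k. measure M {\<omega> \<in> space M. W i \<omega> = {#k#}}"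
  shows "tv_le (\<Sum>i<m. (\<Sum>k\<in>J. r i k)\<^sup>2) (rv_pmf M (\<lambda>\<omega>. \<Sum>i<m. W i \<omega>))
           (poisson_config J (\<lambda>k. \<Sum>i<m. r i k))"
proof (induction m)
  case 0
  interpret prob_space M by fact
  have "rv_pmf M (\<lambda>\<omega>. {#}) = (return_pmf {#} :: 'k multiset pmf)"
    by (rule pmf_eqI) (auto simp: pmf_rv_pmf[OF M] prob_space indicator_def)
  then show ?case using tv_empty_poisson[OF J, of "\<lambda>_. 0"] by simp
next
  case (Suc m)
  interpret prob_space M by fact
  have rv: "W i \<in> M \<rightarrow>\<^sub>M count_space UNIV" for i using ind by (auto simp: indep_vars_def)
  have "indep_var (count_space UNIV) ((\<lambda>f. \<Sum>i<m. f i) \<circ> (\<lambda>\<omega>. restrict (\<lambda>i. W i \<omega>) {..<m}))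
      (count_space UNIV) ((\<lambda>f. f m) \<circ> (\<lambda>\<omega>. restrict (\<lambda>i. W i \<omega>) {m}))"
    by (intro indep_var_compose[OF indep_var_restrict[OF ind]] measurable_sum_count_space) auto
  also have "(\<lambda>f. \<Sum>i<m. f i) \<circ> (\<lambda>\<omega>. restrict (\<lambda>i. W i \<omega>) {..<m}) = (\<lambda>\<omega>. \<Sum>i<m. W i \<omega>)"
    by auto
  also have "(\<lambda>f. f m) \<circ> (\<lambda>\<omega>. restrict (\<lambda>i. W i \<omega>) {m}) = W m" by auto
  finally have "rv_pmf M (\<lambda>\<omega>. \<Sum>i<Suc m. W i \<omega>) = conv_pmf (rv_pmf M (\<lambda>\<omega>. \<Sum>i<m. W i \<omega>)) (rv_pmf M (W m))"
    using rv_pmf_add[OF M] by simp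
  moreover have "poisson_config J (\<lambda>k. \<Sum>i<Suc m. r i k) =
      conv_pmf (poisson_config J (\<lambda>k. \<Sum>i<m. r i k)) (poisson_config J (r m))"
    using J by (subst poisson_config_add) (auto simp: r_def intro!: sum_nonneg)
  moreover have "tv_le ((\<Sum>k\<in>J. r m k)\<^sup>2) (rv_pmf M (W m)) (poisson_config J (r m))"
    using tv_single_point_poisson[OF J, of "rv_pmf M (W m)"] set_rv_pmf[OF M rv] W
    unfolding pmf_rv_pmf[OF M rv] r_def by blast
  ultimately show ?case using tv_le_conv[OF Suc.IH] by simp
qed

text \<open>The excess of the intensity \<open>t\<close> over the sum of the first \<open>m\<close> intensities is split off as a separate
Poisson configuration and compared with the empty one.\<close>

lemma tv_sum_labels_poisson_remainder:
  fixes W :: "nat \<Rightarrow> 'w \<Rightarrow> 'k::countable multiset"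
  assumes M: "prob_space M" and J: "finite J"
    and ind: "prob_space.indep_vars M (\<lambda>_. count_space UNIV) W UNIV"
    and W: "\<And>i \<omega>. W i \<omega> \<in> insert {#} ((\<lambda>k. {#k#}) ` J)"
  defines "r \<equiv> \<lambda>i k. measure M {\<omega> \<in> space M. W i \<omega> = {#k#}}"
  assumes t: "\<And>k. k \<in> J \<Longrightarrow> (\<Sum>i<m. r i k) \<le> t k"
  shows "tv_le ((\<Sum>i<m. (\<Sum>k\<in>J. r i k)\<^sup>2) + (\<Sum>k\<in>J. t k - (\<Sum>i<m. r i k)))
           (rv_pmf M (\<lambda>\<omega>. \<Sum>i<m. W i \<omega>)) (poisson_config J t)"
proof -
  have "tv_le ((\<Sum>i<m. (\<Sum>k\<in>J. r i k)\<^sup>2) + (\<Sum>k\<in>J. t k - (\<Sum>i<m. r i k)))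
      (conv_pmf (rv_pmf M (\<lambda>\<omega>. \<Sum>i<m. W i \<omega>)) (return_pmf {#}))
      (conv_pmf (poisson_config J (\<lambda>k. \<Sum>i<m. r i k)) (poisson_config J (\<lambda>k. t k - (\<Sum>i<m. r i k))))"
    unfolding r_def
    using t J by (intro tv_le_conv tv_sum_labels_poisson[OF M J ind W] tv_empty_poisson) (auto simp: r_def)
  also have "conv_pmf (poisson_config J (\<lambda>k. \<Sum>i<m. r i k)) (poisson_config J (\<lambda>k. t k - (\<Sum>i<m. r i k)))
      = poisson_config J t"
    using t J by (subst poisson_config_add) (auto simp: r_def intro!: sum_nonneg)
  also have "conv_pmf (rv_pmf M (\<lambda>\<omega>. \<Sum>i<m. W i \<omega>)) (return_pmf {#}) = rv_pmf M (\<lambda>\<omega>. \<Sum>i<m. W i \<omega>)"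
    using conv_pmf_return_0[of "rv_pmf M (\<lambda>\<omega>. \<Sum>i<m. W i \<omega>)"] by simp
  finally show ?thesis .
qed

section \<open>Point measures and their dyadic cell counts\<close>

text \<open>The number of points in \<open>B\<close>.  Point measures take integer values on relatively compact sets, so the
floor only makes the number available as a \<open>nat\<close> there.\<close>

definition cnt :: "'a measure \<Rightarrow> 'a set \<Rightarrow> nat" where
  "cnt \<eta> B = nat \<lfloor>measure \<eta> B\<rfloor>"

lemma sets_dirac_sum [simp]: "sets (dirac_sum E I x) = sets (restrict_space borel E)"
  by (simp add: dirac_sum_def)

lemma space_dirac_sum [simp]: "space (dirac_sum E I x) = E"
  by (simp add: dirac_sum_def space_restrict_space)

lemma sets_point_measure: "\<eta> \<in> point_measures E \<Longrightarrow> sets \<eta> = sets (restrict_space borel E)"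
  by (auto simp: point_measures_def)

lemma space_point_measure: "\<eta> \<in> point_measures E \<Longrightarrow> space \<eta> = E"
  by (auto simp: point_measures_def)

lemma emeasure_point_measure_finite:
  assumes \<eta>: "\<eta> \<in> point_measures E" and "compact K" "K \<subseteq> E" "B \<subseteq> K" "K \<in> sets borel"
  shows "emeasure \<eta> B < \<infinity>"
proof -
  have "emeasure \<eta> B \<le> emeasure \<eta> K"
    using assms by (intro emeasure_mono) (auto simp: sets_point_measure sets_restrict_space)
  also have "\<dots> < \<infinity>" using assms by (auto simp: point_measures_def locally_finite_def)
  finally show ?thesis .
qed

lemma dirac_sum_card:
  assumes B: "B \<in> sets borel" "B \<subseteq> E" and fin: "emeasure (dirac_sum E I x) B < \<infinity>"
  shows "finite {i \<in> I. x i \<in> B}" "measure (dirac_sum E I x) B = real (card {i \<in> I. x i \<in> B})"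
    "cnt (dirac_sum E I x) B = card {i \<in> I. x i \<in> B}"
proof -
  have eq: "emeasure (dirac_sum E I x) B = emeasure (count_space I) {i \<in> I. x i \<in> B}"
    by (rule emeasure_dirac_sum[OF B])
  show f: "finite {i \<in> I. x i \<in> B}"
  proof (rule ccontr)
    assume "infinite {i \<in> I. x i \<in> B}"
    then have "emeasure (count_space I) {i \<in> I. x i \<in> B} = \<infinity>"
      by (subst emeasure_count_space_infinite) auto
    with fin eq show False by simp
  qed
  then show m: "measure (dirac_sum E I x) B = real (card {i \<in> I. x i \<in> B})"
    using eq by (subst measure_def, subst eq, subst emeasure_count_space_finite) auto
  then show "cnt (dirac_sum E I x) B = card {i \<in> I. x i \<in> B}" by (simp add: cnt_def)
qed

lemma measure_point_measure:
  assumes \<eta>: "\<eta> \<in> point_measures E" and B: "B \<in> sets borel" "B \<subseteq> E" and fin: "emeasure \<eta> B < \<infinity>"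
  shows "measure \<eta> B = real (cnt \<eta> B)" "emeasure \<eta> B = of_nat (cnt \<eta> B)"
proof -
  obtain I :: "nat set" and x where eq: "\<eta> = dirac_sum E I x"
    using \<eta> by (auto simp: point_measures_def)
  show m: "measure \<eta> B = real (cnt \<eta> B)"
    using dirac_sum_card[OF B, of I x] fin unfolding eq by simp
  show "emeasure \<eta> B = of_nat (cnt \<eta> B)"
    using emeasure_eq_ennreal_measure[of \<eta> B] fin m by (simp add: ennreal_of_nat_eq_real_of_nat)
qed

lemma finite_interval:
  assumes "\<eta> \<in> point_measures {0::real<..}" "0 < a"
  shows "emeasure \<eta> {a..b} < \<infinity>" "emeasure \<eta> {a<..b} < \<infinity>"
proof -
  have "compact {a..b}" "{a..b} \<subseteq> {0<..}" "{a..b} \<in> sets borel" using assms(2) by auto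
  note * = emeasure_point_measure_finite[OF assms(1) this(1,2) _ this(3)]
  show "emeasure \<eta> {a..b} < \<infinity>" "emeasure \<eta> {a<..b} < \<infinity>" by (rule *; force)+
qed

lemma measurable_integral_vague_borel:
  fixes f :: "'a::topological_space \<Rightarrow> real"
  assumes "continuous_on E f" "compact K" "K \<subseteq> E" "\<And>x. x \<in> E - K \<Longrightarrow> f x = 0"
  shows "(\<lambda>\<eta>. \<integral>x. f x \<partial>\<eta>) \<in> borel_measurable (vague_borel E)"
proof (rule borel_measurableI)
  fix U :: "real set" assume "open U"
  then have "openin (vague_topology E) {\<eta> \<in> point_measures E. (\<integral>x. f x \<partial>\<eta>) \<in> U}"
    unfolding vague_topology_def using assms by (intro topology_generated_by_Basis) blast
  moreover have "(\<lambda>\<eta>. \<integral>x. f x \<partial>\<eta>) -` U \<inter> space (vague_borel E) = {\<eta> \<in> point_measures E. (\<integral>x. f x \<partial>\<eta>) \<in> U}"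
    by auto
  moreover have "{U. openin (vague_topology E) U} \<subseteq> Pow (point_measures E)"
    using openin_subset[of "vague_topology E"] by auto
  ultimately show "(\<lambda>\<eta>. \<integral>x. f x \<partial>\<eta>) -` U \<inter> space (vague_borel E) \<in> sets (vague_borel E)"
    unfolding vague_borel_def by (auto intro!: sigma_sets.Basic)
qed

text \<open>The indicator of the interval is a pointwise limit of continuous trapezoids that vanish outside
\<open>[a, b + 1]\<close>; their integrals are vaguely continuous functions of the measure.\<close>

lemma measurable_measure_interval:
  assumes a: "0 < a"
  shows "(\<lambda>\<eta>. measure \<eta> {a<..b}) \<in> borel_measurable (vague_borel {0::real<..})"
proof -
  define f where "f n x = max 0 (min 1 (min (real (Suc n) * (x - a)) (1 + real (Suc n) * (b - x))))"
    for n and x :: real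
  have f0: "f n x = 0" if "x \<notin> {a..b + 1}" for n x
  proof -
    have "x < a \<or> b + 1 < x" using that by auto
    then show ?thesis
    proof
      assume "x < a"
      then have "real (Suc n) * (x - a) \<le> 0" by (intro mult_nonneg_nonpos) auto
      then show ?thesis by (simp add: f_def)
    next
      assume x: "b + 1 < x"
      then have "1 * (x - b) \<le> real (Suc n) * (x - b)" by (intro mult_right_mono) auto
      then have "1 + real (Suc n) * (b - x) \<le> 0" using x by (simp add: algebra_simps)
      then show ?thesis by (simp add: f_def)
    qed
  qed
  have f1: "\<bar>f n x\<bar> \<le> 1" for n x by (simp add: f_def)
  have lim: "(\<lambda>n. f n x) \<longlonglongrightarrow> indicator {a<..b} x" for x
  proof -
    consider "x \<le> a" | "a < x" "x \<le> b" | "b < x" by linarith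
    then show ?thesis
    proof cases
      case 1
      then have "real (Suc n) * (x - a) \<le> 0" for n by (intro mult_nonneg_nonpos) auto
      then have "f n x = 0" for n unfolding f_def using \<open>\<And>n. real (Suc n) * (x - a) \<le> 0\<close>[of n] by linarith
      then show ?thesis using 1 by simp
    next
      case 2
      obtain m where m: "1 < real m * (x - a)" using 2 reals_Archimedean3[of "x - a"] by auto
      have "f n x = 1" if "m \<le> n" for n
      proof -
        have "real m * (x - a) \<le> real (Suc n) * (x - a)"
          using that 2 by (intro mult_right_mono) auto
        moreover have "0 \<le> real (Suc n) * (b - x)" using 2 by auto
        ultimately show ?thesis using m by (simp add: f_def)
      qed
      then show ?thesis using 2
        by (intro tendsto_eventually) (auto simp: eventually_sequentially)
    next
      case 3
      obtain m where m: "1 < real m * (x - b)" using 3 reals_Archimedean3[of "x - b"] by auto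
      have "f n x = 0" if "m \<le> n" for n
      proof -
        have "real m * (x - b) \<le> real (Suc n) * (x - b)"
          using that 3 by (intro mult_right_mono) auto
        then have "1 + real (Suc n) * (b - x) \<le> 0" using m by (simp add: algebra_simps)
        then show ?thesis by (simp add: f_def)
      qed
      then show ?thesis using 3
        by (intro tendsto_eventually) (auto simp: eventually_sequentially)
    qed
  qed
  have cont: "continuous_on S (f n)" for n S unfolding f_def by (intro continuous_intros)
  show ?thesis
  proof (rule borel_measurable_LIMSEQ_real)
    fix n show "(\<lambda>\<eta>. \<integral>x. f n x \<partial>\<eta>) \<in> borel_measurable (vague_borel {0<..})"
      using a f0 by (intro measurable_integral_vague_borel[where K = "{a..b + 1}"] cont) auto
  next
    fix \<eta> assume "\<eta> \<in> space (vague_borel {0::real<..})"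
    then have \<eta>: "\<eta> \<in> point_measures {0<..}" by simp
    have fin: "emeasure \<eta> {a..b + 1} < \<infinity>" using finite_interval(1)[OF \<eta> a] .
    have sub: "{a..b+1} \<in> sets \<eta>" "{a<..b} \<in> sets \<eta>"
      using a by (auto simp: sets_point_measure[OF \<eta>] sets_restrict_space image_iff)
    have "(\<lambda>n. \<integral>x. f n x \<partial>\<eta>) \<longlonglongrightarrow> (\<integral>x. indicator {a<..b} x \<partial>\<eta>)"
    proof (rule integral_dominated_convergence[where w = "indicator {a..b + 1}"])
      show "integrable \<eta> (indicator {a..b + 1} :: real \<Rightarrow> real)" using sub fin by simp
      show "f n \<in> borel_measurable \<eta>" for n
        using borel_measurable_continuous_onI[OF cont]
        by (subst measurable_cong_sets[OF sets_point_measure[OF \<eta>] refl]) (rule measurable_restrict_space1)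
      show "AE x in \<eta>. norm (f n x) \<le> indicator {a..b + 1} x" for n
        using f0 f1 by (intro AE_I2) (auto simp: indicator_def)
    qed (use lim sub in auto)
    also have "(\<integral>x. indicator {a<..b} x \<partial>\<eta>) = measure \<eta> {a<..b}"
      using sub sets.Int_space_eq2[OF sub(2)] by simp
    finally show "(\<lambda>n. \<integral>x. f n x \<partial>\<eta>) \<longlonglongrightarrow> measure \<eta> {a<..b}" .
  qed
qed

text \<open>The dyadic grid is scaled by \<open>\<tau>\<close>, so that on every level \<open>(0,\<tau>]\<close> is exactly the union of the cells with
\<open>k < 2 ^ n\<close>.  The cell with \<open>k = 0\<close> touches 0 and is never counted: it may contain infinitely many
points.\<close>

definition cell :: "real \<Rightarrow> nat \<Rightarrow> nat \<Rightarrow> real set" where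
  "cell \<tau> n k = {\<tau> * real k / 2 ^ n <.. \<tau> * (real k + 1) / 2 ^ n}"

lemma cell_iff:
  "0 < \<tau> \<Longrightarrow> x \<in> cell \<tau> n k \<longleftrightarrow> real k < x * 2 ^ n / \<tau> \<and> x * 2 ^ n / \<tau> \<le> real k + 1"
  by (auto simp: cell_def field_simps)

lemma cell_borel [simp]: "cell \<tau> n k \<in> sets borel"
  by (simp add: cell_def)

lemma cell_pos:
  assumes "0 < \<tau>" shows "cell \<tau> n k \<subseteq> {0<..}"
proof
  fix x assume "x \<in> cell \<tau> n k"
  moreover have "0 \<le> \<tau> * real k / 2 ^ n" using assms by simp
  ultimately show "x \<in> {0<..}" unfolding cell_def greaterThanAtMost_iff greaterThan_iff by linarith
qed

lemma cell_disjoint: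
  assumes "0 < \<tau>" "x \<in> cell \<tau> n k" "x \<in> cell \<tau> n j" shows "k = j"
  using assms(2,3) unfolding cell_iff[OF assms(1)] by linarith

lemma disjoint_family_on_cell: "0 < \<tau> \<Longrightarrow> disjoint_family_on (cell \<tau> n) J"
  by (auto simp: disjoint_family_on_def dest: cell_disjoint)

text \<open>Away from 0 the cells are relatively compact, so that point measures are finite on them.\<close>

lemma cell_relcompact:
  assumes "0 < \<tau>" "1 \<le> k"
  shows "\<exists>K. compact K \<and> K \<subseteq> {0<..} \<and> cell \<tau> n k \<subseteq> K"
proof (intro exI conjI)
  let ?K = "{\<tau> * real k / 2 ^ n .. \<tau> * (real k + 1) / 2 ^ n}"
  have "0 < \<tau> * real k / 2 ^ n" using assms by simp
  then show "?K \<subseteq> {0<..}" by (meson atLeastAtMost_iff greaterThan_iff less_le_trans subsetI)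
  show "cell \<tau> n k \<subseteq> ?K" unfolding cell_def by (rule greaterThanAtMost_subseteq_atLeastAtMost_iff[THEN iffD2]) simp
qed simp

lemma cell_split:
  assumes "0 < \<tau>"
  shows "cell \<tau> n k = cell \<tau> (Suc n) (2 * k) \<union> cell \<tau> (Suc n) (Suc (2 * k))"
proof (rule set_eqI)
  fix x
  define y where "y = x * 2 ^ n / \<tau>"
  have 1: "x \<in> cell \<tau> n k \<longleftrightarrow> real k < y \<and> y \<le> real k + 1"
    unfolding cell_iff[OF assms] y_def ..
  have 2: "x \<in> cell \<tau> (Suc n) j \<longleftrightarrow> real j < 2 * y \<and> 2 * y \<le> real j + 1" for j
    unfolding cell_iff[OF assms] y_def by (simp add: mult_ac)
  show "x \<in> cell \<tau> n k \<longleftrightarrow> x \<in> cell \<tau> (Suc n) (2 * k) \<union> cell \<tau> (Suc n) (Suc (2 * k))"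
    unfolding Un_iff 1 2 by auto
qed

lemma ex_cell:
  assumes "0 < \<tau>" "0 < x" shows "\<exists>k. x \<in> cell \<tau> n k"
proof
  let ?y = "x * 2 ^ n / \<tau>"
  have "0 < ?y" using assms by simp
  then have "real (nat (\<lceil>?y\<rceil> - 1)) = of_int \<lceil>?y\<rceil> - 1" by linarith
  then show "x \<in> cell \<tau> n (nat (\<lceil>?y\<rceil> - 1))"
    unfolding cell_iff[OF assms(1)] by linarith
qed

lemma cell_measure:
  assumes "\<eta> \<in> point_measures {0<..}" "0 < \<tau>" "1 \<le> k"
  shows "emeasure \<eta> (cell \<tau> n k) < \<infinity>" "measure \<eta> (cell \<tau> n k) = real (cnt \<eta> (cell \<tau> n k))"
    "emeasure \<eta> (cell \<tau> n k) = of_nat (cnt \<eta> (cell \<tau> n k))"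
    "cell \<tau> n k \<in> sets \<eta>"
proof -
  show fin: "emeasure \<eta> (cell \<tau> n k) < \<infinity>"
    unfolding cell_def using assms by (intro finite_interval) auto
  show "measure \<eta> (cell \<tau> n k) = real (cnt \<eta> (cell \<tau> n k))"
    "emeasure \<eta> (cell \<tau> n k) = of_nat (cnt \<eta> (cell \<tau> n k))"
    using measure_point_measure[OF assms(1) _ _ fin] cell_pos[OF assms(2)] by auto
  show "cell \<tau> n k \<in> sets \<eta>"
    using cell_pos[OF assms(2), of n k] unfolding sets_point_measure[OF assms(1)] sets_restrict_space
    by (auto simp: image_iff intro!: bexI[of _ "cell \<tau> n k"])
qed

lemma cnt_cell_split:
  assumes \<eta>: "\<eta> \<in> point_measures {0<..}" and \<tau>: "0 < \<tau>" and k: "1 \<le> k"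
  shows "cnt \<eta> (cell \<tau> n k) = cnt \<eta> (cell \<tau> (Suc n) (2 * k)) + cnt \<eta> (cell \<tau> (Suc n) (Suc (2 * k)))"
proof -
  have "cell \<tau> (Suc n) (2 * k) \<inter> cell \<tau> (Suc n) (Suc (2 * k)) = {}"
  proof -
    have "2 * k \<noteq> Suc (2 * k)" by simp
    then show ?thesis using cell_disjoint[OF \<tau>, of _ "Suc n" "2 * k" "Suc (2 * k)"] by blast
  qed
  then have "emeasure \<eta> (cell \<tau> n k) = emeasure \<eta> (cell \<tau> (Suc n) (2 * k)) + emeasure \<eta> (cell \<tau> (Suc n) (Suc (2 * k)))"
    unfolding cell_split[OF \<tau>, of n] using k by (intro plus_emeasure[symmetric] cell_measure[OF \<eta> \<tau>]) auto
  then have "(of_nat (cnt \<eta> (cell \<tau> n k)) :: ennreal) =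
      of_nat (cnt \<eta> (cell \<tau> (Suc n) (2 * k)) + cnt \<eta> (cell \<tau> (Suc n) (Suc (2 * k))))"
    using k unfolding of_nat_add by (subst (asm) (1 2 3) cell_measure(3)[OF \<eta> \<tau>]) auto
  then show ?thesis by (simp only: of_nat_eq_iff)
qed

definition dyadic_counts :: "real \<Rightarrow> nat \<Rightarrow> nat set \<Rightarrow> real measure \<Rightarrow> nat multiset" where
  "dyadic_counts \<tau> n J \<eta> = config J (\<lambda>k. cnt \<eta> (cell \<tau> n k))"

lemma measurable_config:
  fixes c :: "'w \<Rightarrow> 'k::countable \<Rightarrow> nat"
  assumes "finite J" "\<And>k. k \<in> J \<Longrightarrow> (\<lambda>\<omega>. c \<omega> k) \<in> M \<rightarrow>\<^sub>M count_space UNIV"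
  shows "(\<lambda>\<omega>. config J (c \<omega>)) \<in> M \<rightarrow>\<^sub>M count_space UNIV"
  unfolding config_def
proof (rule measurable_sum_count_space)
  fix k assume "k \<in> J"
  then show "(\<lambda>\<omega>. replicate_mset (c \<omega> k) k) \<in> M \<rightarrow>\<^sub>M count_space UNIV"
    by (rule measurable_compose[OF assms(2)]) simp
qed

lemma measurable_dyadic_counts:
  assumes "0 < \<tau>" "finite J" "0 \<notin> J"
  shows "dyadic_counts \<tau> n J \<in> vague_borel {0<..} \<rightarrow>\<^sub>M count_space UNIV"
  unfolding dyadic_counts_def
proof (rule measurable_config)
  fix k assume "k \<in> J"
  then have "0 < \<tau> * real k / 2 ^ n" using assms by (cases k) auto
  then have m: "(\<lambda>\<eta>. measure \<eta> (cell \<tau> n k)) \<in> borel_measurable (vague_borel {0<..})"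
    unfolding cell_def by (rule measurable_measure_interval)
  show "(\<lambda>\<eta>. cnt \<eta> (cell \<tau> n k)) \<in> vague_borel {0<..} \<rightarrow>\<^sub>M count_space UNIV"
    unfolding cnt_def by (rule measurable_compose[OF m]) measurable
qed (rule assms(2))

section \<open>Cell counts generate the vague Borel sigma-algebra\<close>

text \<open>Replace \<open>f\<close> by its value at the right endpoint of each cell.  By uniform continuity this changes \<open>f\<close>
little on the cells that meet the support, and the integral of the resulting step function is a
function of the counts.  The total mass that multiplies the error is also the same for both
measures, since it is a sum of counts.\<close>

lemma integral_determined_by_dyadic_counts:
  fixes f :: "real \<Rightarrow> real"
  assumes \<tau>: "0 < \<tau>" and f: "continuous_on {0<..} f" "compact K" "K \<subseteq> {0<..}" "\<And>x. x \<in> {0<..} - K \<Longrightarrow> f x = 0"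
    and \<eta>: "\<eta> \<in> point_measures {0<..}" and e: "0 < e"
  shows "\<exists>n0. \<forall>n\<ge>n0. \<forall>\<eta>'\<in>point_measures {0<..}.
    dyadic_counts \<tau> n {1..<4 ^ n} \<eta>' = dyadic_counts \<tau> n {1..<4 ^ n} \<eta> \<longrightarrow>
    \<bar>(\<integral>x. f x \<partial>\<eta>') - (\<integral>x. f x \<partial>\<eta>)\<bar> < e"
proof -
  obtain a b where ab: "0 < a" "a \<le> b" "K \<subseteq> {a..b}"
  proof (cases "K = {}")
    case True then show ?thesis using that[of 1 1] by auto
  next
    case False
    obtain a where a: "a \<in> K" "\<And>y. y \<in> K \<Longrightarrow> a \<le> y" using compact_attains_inf[OF f(2) False] by blast
    obtain b where b: "b \<in> K" "\<And>y. y \<in> K \<Longrightarrow> y \<le> b" using compact_attains_sup[OF f(2) False] by blast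
    have "0 < a" using a(1) f(3) by auto
    moreover have "a \<le> b" using a b by simp
    moreover have "K \<subseteq> {a..b}" using a b by auto
    ultimately show ?thesis by (rule that)
  qed
  \<comment> \<open>A fixed compact neighbourhood of the support, which contains every sufficiently small cell
    that meets \<open>[a, b]\<close>.\<close>
  let ?D = "{a / 2..2 * b}"
  define m where "m = measure \<eta> ?D"
  \<comment> \<open>The step function is compared with \<open>f\<close> once for each measure, hence the factor 2; the mass \<open>m\<close>
    may vanish, hence the \<open>+ 1\<close>.\<close>
  define e' where "e' = e / (2 * (m + 1))"
  have m: "0 \<le> m" by (simp add: m_def)
  have e': "0 < e'" "2 * (e' * m) < e" using e m by (auto simp: e'_def field_simps)
  have "uniformly_continuous_on ?D f"
    using ab f(1) by (intro compact_uniformly_continuous) (auto intro: continuous_on_subset)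
  then obtain d where d: "0 < d" "\<And>x y. x \<in> ?D \<Longrightarrow> y \<in> ?D \<Longrightarrow> dist x y < d \<Longrightarrow> dist (f x) (f y) < e'"
    using e'(1) unfolding uniformly_continuous_on_def by metis
  have "(\<lambda>n. \<tau> / 2 ^ n) \<longlonglongrightarrow> 0" by (rule LIMSEQ_divide_realpow_zero) simp
  then have ev1: "\<forall>\<^sub>F n in sequentially. \<tau> / 2 ^ n < min d (min (a / 2) b)"
    using d ab by (intro order_tendstoD) auto
  obtain n1 where n1: "b / \<tau> < 2 ^ n1" using real_arch_pow[of 2 "b / \<tau>"] by auto
  have "b / \<tau> < 2 ^ n" if "n1 \<le> n" for n
    by (rule order_less_le_trans[OF n1 power_increasing[OF that]]) simp
  then have "\<forall>\<^sub>F n in sequentially. b / \<tau> < 2 ^ n" by (auto simp: eventually_sequentially)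
  with ev1 have "\<forall>\<^sub>F n in sequentially. \<tau> / 2 ^ n < min d (min (a / 2) b) \<and> b / \<tau> < 2 ^ n"
    by (rule eventually_conj)
  then obtain n0 where n0: "\<And>n. n0 \<le> n \<Longrightarrow> \<tau> / 2 ^ n < min d (min (a / 2) b) \<and> b / \<tau> < 2 ^ n"
    by (auto simp: eventually_sequentially)
  show ?thesis
  proof (intro exI[of _ n0] allI impI ballI)
    fix n \<eta>' assume n: "n0 \<le> n" and \<eta>': "\<eta>' \<in> point_measures {0<..}"
      and counts: "dyadic_counts \<tau> n {1..<4 ^ n} \<eta>' = dyadic_counts \<tau> n {1..<4 ^ n} \<eta>"
    let ?c = "cell \<tau> n" and ?h = "\<tau> / 2 ^ n"
    have h: "?h < d" "?h < a / 2" "?h < b" "b / \<tau> < 2 ^ n" using n0[OF n] by auto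
    define L where "L = {k \<in> {1..<4 ^ n}. ?c k \<inter> {a..b} \<noteq> {}}"
    define r where "r k = \<tau> * (real k + 1) / 2 ^ n" for k
    have [simp]: "finite L" by (simp add: L_def)
    have L1: "1 \<le> k" if "k \<in> L" for k using that by (simp add: L_def)
    have r: "r k \<in> ?c k" for k using \<tau> by (simp add: r_def cell_def divide_strict_right_mono)
    have diam: "\<bar>x - y\<bar> \<le> \<tau> / 2 ^ n" if "x \<in> ?c k" "y \<in> ?c k" for x y k
    proof -
      have "\<tau> * (real k + 1) / 2 ^ n = \<tau> * real k / 2 ^ n + \<tau> / 2 ^ n"
        by (simp add: algebra_simps add_divide_distrib)
      then show ?thesis using that unfolding cell_def greaterThanAtMost_iff by linarith
    qed
    have LD: "?c k \<subseteq> ?D" if k: "k \<in> L" for k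
    proof
      fix x assume x: "x \<in> ?c k"
      obtain y where y: "y \<in> ?c k" "a \<le> y" "y \<le> b" using k by (auto simp: L_def)
      show "x \<in> ?D" using diam[OF x y(1)] h y unfolding atLeastAtMost_iff by linarith
    qed
    have single: "(\<Sum>k\<in>L. g k * indicator (?c k) x) = g j" if "x \<in> ?c j" "j \<in> L" for g :: "nat \<Rightarrow> real" and x j
    proof -
      have "(\<Sum>k\<in>L. g k * indicator (?c k) x) = (\<Sum>k\<in>L. if k = j then g k else 0)"
        using that cell_disjoint[OF \<tau>, of x n] by (intro sum.cong refl) (auto simp: indicator_def)
      then show ?thesis using that by simp
    qed
    define s where "s x = (\<Sum>k\<in>L. f (r k) * indicator (?c k) x)" for x
    define u where "u x = (\<Sum>k\<in>L. e' * indicator (?c k) x)" for x :: real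
    have fs: "\<bar>f x - s x\<bar> \<le> u x" if x: "0 < x" for x
    proof (cases "\<exists>j\<in>L. x \<in> ?c j")
      case True
      then obtain j where j: "j \<in> L" "x \<in> ?c j" by blast
      have "dist (f x) (f (r j)) < e'"
        using LD[OF j(1)] r[of j] j(2) diam[OF j(2) r] h(1) by (intro d) (auto simp only: dist_real_def)
      moreover have "s x = f (r j)" "u x = e'" unfolding s_def u_def by (rule single[OF j(2,1)])+
      ultimately show ?thesis by (simp add: dist_real_def)
    next
      case False
      then have "s x = 0" "u x = 0" by (auto simp: s_def u_def intro!: sum.neutral)
      moreover have "f x = 0"
      proof (rule ccontr)
        assume "f x \<noteq> 0"
        then have "x \<in> K" using f(4)[of x] x by auto
        then have xab: "a \<le> x" "x \<le> b" using ab(3) by auto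
        obtain k where k: "x \<in> ?c k" using ex_cell[OF \<tau> x] by blast
        have ks: "real k < x * 2 ^ n / \<tau>" "x * 2 ^ n / \<tau> \<le> real k + 1"
          using k unfolding cell_iff[OF \<tau>] by auto
        have "\<tau> / 2 ^ n < x" using h(2) xab ab by linarith
        then have "1 < x * 2 ^ n / \<tau>" using \<tau> by (simp add: field_simps)
        then have "1 \<le> k" using ks by linarith
        moreover have "k < 4 ^ n"
        proof -
          have "x * 2 ^ n / \<tau> \<le> (b / \<tau>) * 2 ^ n" using xab \<tau> by (simp add: field_simps)
          also have "\<dots> \<le> 2 ^ n * 2 ^ n" using h(4) by (intro mult_right_mono) auto
          finally have "real k < 2 ^ n * 2 ^ n" using ks by simp
          then have "real k < real (4 ^ n)" by (simp flip: power_mult_distrib)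
          then show ?thesis by (simp only: of_nat_less_iff)
        qed
        ultimately have "k \<in> L" using k xab by (auto simp: L_def)
        with False k show False by blast
      qed
      ultimately show ?thesis by simp
    qed
    have step: "\<bar>(\<integral>x. f x \<partial>\<zeta>) - (\<Sum>k\<in>L. f (r k) * measure \<zeta> (?c k))\<bar> \<le> e' * (\<Sum>k\<in>L. measure \<zeta> (?c k))"
      if \<zeta>: "\<zeta> \<in> point_measures {0<..}" for \<zeta>
    proof -
      note c = cell_measure[OF \<zeta> \<tau> L1]
      have int: "integrable \<zeta> (\<lambda>x. g k * indicator (?c k) x)" if "k \<in> L" for g :: "nat \<Rightarrow> real" and k
        using c[OF that] by simp
      have "(\<integral>x. s x \<partial>\<zeta>) = (\<Sum>k\<in>L. \<integral>x. f (r k) * indicator (?c k) x \<partial>\<zeta>)"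
        unfolding s_def by (rule Bochner_Integration.integral_sum) (rule int)
      also have "\<dots> = (\<Sum>k\<in>L. f (r k) * measure \<zeta> (?c k))"
        using c by (intro sum.cong refl) (simp add: sets.Int_space_eq2)
      finally have Is: "(\<integral>x. s x \<partial>\<zeta>) = (\<Sum>k\<in>L. f (r k) * measure \<zeta> (?c k))" .
      have "(\<integral>x. u x \<partial>\<zeta>) = (\<Sum>k\<in>L. \<integral>x. e' * indicator (?c k) x \<partial>\<zeta>)"
        unfolding u_def by (rule Bochner_Integration.integral_sum) (rule int)
      also have "\<dots> = e' * (\<Sum>k\<in>L. measure \<zeta> (?c k))"
        unfolding sum_distrib_left using c by (intro sum.cong refl) (simp add: sets.Int_space_eq2)
      finally have Iu: "(\<integral>x. u x \<partial>\<zeta>) = e' * (\<Sum>k\<in>L. measure \<zeta> (?c k))" .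
      have ints: "integrable \<zeta> s" "integrable \<zeta> u"
        unfolding s_def u_def by (rule Bochner_Integration.integrable_sum, erule int)+
      have fm: "f \<in> borel_measurable \<zeta>"
        using borel_measurable_continuous_on_restrict[OF f(1)]
        by (simp add: measurable_cong_sets[OF sets_point_measure[OF \<zeta>] refl])
      have intf: "integrable \<zeta> f"
      proof (rule Bochner_Integration.integrable_bound[OF _ fm])
        show "integrable \<zeta> (\<lambda>x. \<bar>s x\<bar> + u x)" using ints by auto
        show "AE x in \<zeta>. norm (f x) \<le> norm (\<bar>s x\<bar> + u x)"
        proof (rule AE_I2)
          fix x assume "x \<in> space \<zeta>"
          then have "0 < x" using space_point_measure[OF \<zeta>] by auto
          with fs[OF this] show "norm (f x) \<le> norm (\<bar>s x\<bar> + u x)" by simp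
        qed
      qed
      have "\<bar>(\<integral>x. f x \<partial>\<zeta>) - (\<integral>x. s x \<partial>\<zeta>)\<bar> = \<bar>\<integral>x. f x - s x \<partial>\<zeta>\<bar>" using intf ints by simp
      also have "\<dots> \<le> (\<integral>x. \<bar>f x - s x\<bar> \<partial>\<zeta>)" by (rule integral_abs_bound)
      also have "\<dots> \<le> (\<integral>x. u x \<partial>\<zeta>)"
        using intf ints fs space_point_measure[OF \<zeta>] by (intro integral_mono) auto
      finally show ?thesis unfolding Is Iu .
    qed
    have same: "measure \<eta>' (?c k) = measure \<eta> (?c k)" if "k \<in> L" for k
    proof -
      have "k \<in> {1..<4 ^ n}" using that by (simp add: L_def)
      then have "cnt \<eta>' (?c k) = cnt \<eta> (?c k)"
        using arg_cong[OF counts, of "\<lambda>m. count m k"] by (simp add: dyadic_counts_def count_config)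
      then show ?thesis using cell_measure(2)[OF _ \<tau> L1[OF that]] \<eta> \<eta>' by simp
    qed
    have "(\<Sum>k\<in>L. measure \<eta> (?c k)) = measure \<eta> (\<Union>k\<in>L. ?c k)"
      using cell_measure[OF \<eta> \<tau> L1] disjoint_family_on_cell[OF \<tau>]
      by (intro measure_finite_Union[symmetric]) auto
    also have "\<dots> \<le> measure \<eta> ?D"
    proof (rule measure_mono_fmeasurable)
      show "(\<Union>k\<in>L. ?c k) \<subseteq> ?D" using LD by auto
      show "(\<Union>k\<in>L. ?c k) \<in> sets \<eta>" using cell_measure(4)[OF \<eta> \<tau> L1] by auto
      have "?D \<in> sets \<eta>"
        using ab by (auto simp: sets_point_measure[OF \<eta>] sets_restrict_space image_iff intro!: bexI[of _ ?D])
      then show "?D \<in> fmeasurable \<eta>"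
        using finite_interval(1)[OF \<eta>, of "a / 2" "2 * b"] ab by (auto intro!: fmeasurableI)
    qed
    finally have mass: "(\<Sum>k\<in>L. measure \<eta> (?c k)) \<le> m" by (simp add: m_def)
    have "\<bar>(\<integral>x. f x \<partial>\<eta>') - (\<integral>x. f x \<partial>\<eta>)\<bar> \<le> 2 * (e' * (\<Sum>k\<in>L. measure \<eta> (?c k)))"
      using step[OF \<eta>] step[OF \<eta>'] by (simp add: same)
    also have "\<dots> \<le> 2 * (e' * m)" using mass e' by (intro mult_left_mono) auto
    also have "\<dots> < e" by (rule e')
    finally show "\<bar>(\<integral>x. f x \<partial>\<eta>') - (\<integral>x. f x \<partial>\<eta>)\<bar> < e" .
  qed
qed

text \<open>The sets of point measures with the same counts of level \<open>n\<close> shrink as \<open>n\<close> grows and play the role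
of a neighbourhood base, although they are not open themselves.  Quantifying over all \<open>n \<ge> n0\<close> makes
the property stable under intersections.\<close>

lemma vague_open_contains_count_class:
  assumes \<tau>: "0 < \<tau>" and U: "openin (vague_topology {0<..}) U" and \<eta>: "\<eta> \<in> U"
  shows "\<exists>n0. \<forall>n\<ge>n0. \<forall>\<eta>'\<in>point_measures {0<..}.
    dyadic_counts \<tau> n {1..<4 ^ n} \<eta>' = dyadic_counts \<tau> n {1..<4 ^ n} \<eta> \<longrightarrow> \<eta>' \<in> U"
  using openin_topology_generated_by[OF U[unfolded vague_topology_def]] \<eta>
proof (induction arbitrary: \<eta> rule: generate_topology_on.induct)
  case (Int U V)
  from Int.IH(1)[of \<eta>] Int.IH(2)[of \<eta>] Int.prems obtain n1 n2 where
    "\<forall>n\<ge>n1. \<forall>\<eta>'\<in>point_measures {0<..}. dyadic_counts \<tau> n {1..<4 ^ n} \<eta>' = dyadic_counts \<tau> n {1..<4 ^ n} \<eta> \<longrightarrow> \<eta>' \<in> U"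
    "\<forall>n\<ge>n2. \<forall>\<eta>'\<in>point_measures {0<..}. dyadic_counts \<tau> n {1..<4 ^ n} \<eta>' = dyadic_counts \<tau> n {1..<4 ^ n} \<eta> \<longrightarrow> \<eta>' \<in> V"
    by blast
  then show ?case by (intro exI[of _ "max n1 n2"]) auto
next
  case (UN \<K>)
  then obtain U where "U \<in> \<K>" "\<eta> \<in> U" by blast
  from UN.IH[OF this] this(1) show ?case by blast
next
  case (Basis U)
  then obtain f V K where U: "U = {\<eta> \<in> point_measures {0<..}. (\<integral>x. f x \<partial>\<eta>) \<in> V}"
    and f: "continuous_on {0<..} f" "compact K" "K \<subseteq> {0<..}" "\<And>x. x \<in> {0<..} - K \<Longrightarrow> f x = (0::real)"
    and V: "open V" by blast
  have \<eta>: "\<eta> \<in> point_measures {0<..}" "(\<integral>x. f x \<partial>\<eta>) \<in> V" using Basis.prems U by auto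
  obtain e where e: "0 < e" "\<And>y. dist y (\<integral>x. f x \<partial>\<eta>) < e \<Longrightarrow> y \<in> V"
    using V \<eta>(2) unfolding open_dist by blast
  obtain n0 where n0: "\<And>n \<eta>'. n0 \<le> n \<Longrightarrow> \<eta>' \<in> point_measures {0<..} \<Longrightarrow>
      dyadic_counts \<tau> n {1..<4 ^ n} \<eta>' = dyadic_counts \<tau> n {1..<4 ^ n} \<eta> \<Longrightarrow>
      \<bar>(\<integral>x. f x \<partial>\<eta>') - (\<integral>x. f x \<partial>\<eta>)\<bar> < e"
    using integral_determined_by_dyadic_counts[OF \<tau> f \<eta>(1) e(1)] by blast
  show ?case
  proof (intro exI[of _ n0] allI impI ballI)
    fix n \<eta>' assume a: "n0 \<le> n" "\<eta>' \<in> point_measures {0<..}"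
      "dyadic_counts \<tau> n {1..<4 ^ n} \<eta>' = dyadic_counts \<tau> n {1..<4 ^ n} \<eta>"
    have "(\<integral>x. f x \<partial>\<eta>') \<in> V" using n0[OF a] by (intro e(2)) (simp only: dist_real_def)
    then show "\<eta>' \<in> U" using a(2) unfolding U by blast
  qed
qed simp

lemma dyadic_counts_Suc:
  assumes \<tau>: "0 < \<tau>" and \<eta>: "\<eta> \<in> point_measures {0<..}"
  shows "dyadic_counts \<tau> n {1..<4 ^ n} \<eta> =
    config {1..<4 ^ n} (\<lambda>k. count (dyadic_counts \<tau> (Suc n) {1..<4 ^ Suc n} \<eta>) (2 * k)
      + count (dyadic_counts \<tau> (Suc n) {1..<4 ^ Suc n} \<eta>) (Suc (2 * k)))"
proof (rule multiset_eqI)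
  fix k
  show "count (dyadic_counts \<tau> n {1..<4 ^ n} \<eta>) k =
    count (config {1..<4 ^ n} (\<lambda>k. count (dyadic_counts \<tau> (Suc n) {1..<4 ^ Suc n} \<eta>) (2 * k)
      + count (dyadic_counts \<tau> (Suc n) {1..<4 ^ Suc n} \<eta>) (Suc (2 * k)))) k"
  proof (cases "k \<in> {1..<4 ^ n}")
    case True
    then have "2 * k \<in> {1..<4 ^ Suc n}" "Suc (2 * k) \<in> {1..<4 ^ Suc n}" by auto
    with True cnt_cell_split[OF \<eta> \<tau>, of k n] show ?thesis
      by (simp only: dyadic_counts_def count_config finite_atLeastLessThan if_True atLeastLessThan_iff simp_thms)
  next
    case False
    then show ?thesis by (simp only: dyadic_counts_def count_config finite_atLeastLessThan if_False)
  qed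
qed

text \<open>On level \<open>n\<close> the counts cover \<open>(\<tau> / 2\<^sup>n, \<tau> * 2\<^sup>n]\<close>, which increases with \<open>n\<close>; hence the counts of a finer
level determine those of a coarser one.\<close>

lemma dyadic_counts_refine:
  assumes \<tau>: "0 < \<tau>" and "n \<le> m"
  shows "\<exists>\<phi>. \<forall>\<eta>\<in>point_measures {0<..}.
    dyadic_counts \<tau> n {1..<4 ^ n} \<eta> = \<phi> (dyadic_counts \<tau> m {1..<4 ^ m} \<eta>)"
  using \<open>n \<le> m\<close>
proof (induction m rule: dec_induct)
  case base
  show ?case by (rule exI[of _ id]) simp
next
  case (step m)
  then obtain \<phi> where "\<forall>\<eta>\<in>point_measures {0<..}.
    dyadic_counts \<tau> n {1..<4 ^ n} \<eta> = \<phi> (dyadic_counts \<tau> m {1..<4 ^ m} \<eta>)" by blast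
  then have \<phi>: "dyadic_counts \<tau> n {1..<4 ^ n} \<eta> = \<phi> (dyadic_counts \<tau> m {1..<4 ^ m} \<eta>)"
    if "\<eta> \<in> point_measures {0<..}" for \<eta> using that by blast
  show ?case
  proof (intro exI ballI)
    fix \<eta> assume \<eta>: "\<eta> \<in> point_measures {0::real<..}"
    show "dyadic_counts \<tau> n {1..<4 ^ n} \<eta> =
        (\<lambda>c. \<phi> (config {1..<4 ^ m} (\<lambda>k. count c (2 * k) + count c (Suc (2 * k)))))
          (dyadic_counts \<tau> (Suc m) {1..<4 ^ Suc m} \<eta>)"
      unfolding \<phi>[OF \<eta>] by (rule arg_cong[OF dyadic_counts_Suc[OF \<tau> \<eta>]])
  qed
qed

definition count_events :: "real \<Rightarrow> real measure set set" where
  "count_events \<tau> = {{\<eta> \<in> point_measures {0<..}. dyadic_counts \<tau> n {1..<4 ^ n} \<eta> \<in> C} | n C. True}"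

text \<open>Two events of different levels can both be expressed on the finer of the two levels.\<close>

lemma algebra_count_events:
  assumes \<tau>: "0 < \<tau>" shows "algebra (point_measures {0<..}) (count_events \<tau>)"
  unfolding algebra_iff_Un
proof (intro conjI ballI)
  let ?H = "point_measures {0::real<..}" and ?D = "\<lambda>n. dyadic_counts \<tau> n {1..<4 ^ n}"
  show "count_events \<tau> \<subseteq> Pow ?H" by (auto simp: count_events_def)
  show "{} \<in> count_events \<tau>" unfolding count_events_def by (intro CollectI exI[of _ 0] exI[of _ "{}"]) auto
  fix A assume "A \<in> count_events \<tau>"
  then obtain n C where A: "A = {\<eta> \<in> ?H. ?D n \<eta> \<in> C}" by (auto simp: count_events_def)
  then have "?H - A = {\<eta> \<in> ?H. ?D n \<eta> \<in> - C}" by auto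
  then show "?H - A \<in> count_events \<tau>" unfolding count_events_def by blast
  fix B assume "B \<in> count_events \<tau>"
  then obtain m D where B: "B = {\<eta> \<in> ?H. ?D m \<eta> \<in> D}" by (auto simp: count_events_def)
  obtain \<phi> where \<phi>: "\<And>\<eta>. \<eta> \<in> ?H \<Longrightarrow> ?D n \<eta> = \<phi> (?D (max n m) \<eta>)"
    using dyadic_counts_refine[OF \<tau>, of n "max n m"] by auto
  obtain \<psi> where \<psi>: "\<And>\<eta>. \<eta> \<in> ?H \<Longrightarrow> ?D m \<eta> = \<psi> (?D (max n m) \<eta>)"
    using dyadic_counts_refine[OF \<tau>, of m "max n m"] by auto
  have "A \<union> B = {\<eta> \<in> ?H. ?D (max n m) \<eta> \<in> \<phi> -` C \<union> \<psi> -` D}"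
    using \<phi> \<psi> unfolding A B by auto
  then show "A \<union> B \<in> count_events \<tau>" unfolding count_events_def by blast
qed

text \<open>A vaguely open set is the union of the count classes that it contains, and there are only countably
many count classes in total.\<close>

lemma sets_vague_borel_count_events:
  assumes \<tau>: "0 < \<tau>"
  shows "sets (vague_borel {0<..}) = sigma_sets (point_measures {0<..}) (count_events \<tau>)"
proof
  let ?H = "point_measures {0::real<..}" and ?D = "\<lambda>n. dyadic_counts \<tau> n {1..<4 ^ n}"
  interpret alg: algebra ?H "count_events \<tau>" by (rule algebra_count_events[OF \<tau>])
  interpret sig: sigma_algebra ?H "sigma_sets ?H (count_events \<tau>)"
    by (rule sigma_algebra_sigma_sets[OF alg.space_closed])
  have "U \<in> sigma_sets ?H (count_events \<tau>)" if U: "openin (vague_topology {0<..}) U" for U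
  proof -
    define A where "A p = {\<eta> \<in> ?H. ?D (fst p) \<eta> = snd p}" for p :: "nat \<times> nat multiset"
    have UH: "U \<subseteq> ?H" using openin_subset[OF U] by simp
    have "U = (\<Union>p\<in>{p. A p \<subseteq> U}. A p)"
    proof
      show "U \<subseteq> (\<Union>p\<in>{p. A p \<subseteq> U}. A p)"
      proof
        fix \<eta> assume \<eta>: "\<eta> \<in> U"
        then obtain n where "\<forall>\<eta>'\<in>?H. ?D n \<eta>' = ?D n \<eta> \<longrightarrow> \<eta>' \<in> U"
          using vague_open_contains_count_class[OF \<tau> U] by blast
        then have "A (n, ?D n \<eta>) \<subseteq> U" "\<eta> \<in> A (n, ?D n \<eta>)" using \<eta> UH by (auto simp: A_def)
        then show "\<eta> \<in> (\<Union>p\<in>{p. A p \<subseteq> U}. A p)" by blast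
      qed
    qed auto
    also have "\<dots> \<in> sigma_sets ?H (count_events \<tau>)"
    proof (rule sig.countable_UN'')
      fix p
      have "A p = {\<eta> \<in> ?H. ?D (fst p) \<eta> \<in> {snd p}}" by (auto simp: A_def)
      then show "A p \<in> sigma_sets ?H (count_events \<tau>)"
        unfolding count_events_def by (intro sigma_sets.Basic) blast
    qed auto
    finally show ?thesis .
  qed
  then have "{U. openin (vague_topology {0<..}) U} \<subseteq> sigma_sets ?H (count_events \<tau>)" by blast
  then have "sigma_sets ?H {U. openin (vague_topology {0<..}) U} \<subseteq> sigma_sets ?H (count_events \<tau>)"
    by (rule sig.sigma_sets_subset)
  moreover have "{U. openin (vague_topology {0<..}) U} \<subseteq> Pow ?H"
    using openin_subset[of "vague_topology {0::real<..}"] by auto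
  ultimately show "sets (vague_borel {0<..}) \<subseteq> sigma_sets ?H (count_events \<tau>)"
    unfolding vague_borel_def by simp
  have "count_events \<tau> \<subseteq> sets (vague_borel {0<..})"
  proof
    fix A assume "A \<in> count_events \<tau>"
    then obtain n C where "A = {\<eta> \<in> ?H. ?D n \<eta> \<in> C}" by (auto simp: count_events_def)
    then have "A = ?D n -` C \<inter> space (vague_borel {0<..})" by auto
    also have "\<dots> \<in> sets (vague_borel {0<..})"
      using measurable_dyadic_counts[OF \<tau>, of "{1..<4 ^ n}" n] by (rule measurable_sets) auto
    finally show "A \<in> sets (vague_borel {0<..})" .
  qed
  then show "sigma_sets ?H (count_events \<tau>) \<subseteq> sets (vague_borel {0<..})"
    using sets.sigma_sets_subset[of "count_events \<tau>" "vague_borel {0<..}"] by simp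
qed

lemma emeasure_restr:
  assumes \<eta>: "sets \<eta> = sets (restrict_space borel {0<..})" and B: "B \<in> sets borel" "B \<subseteq> {0<..}"
  shows "emeasure (restr \<tau> \<eta>) B = emeasure \<eta> (B \<inter> {0<..\<tau>})"
proof -
  have 1: "A \<in> sets \<eta>" if "A \<in> sets borel" "A \<subseteq> {0<..}" for A
    using that unfolding \<eta> sets_restrict_space by (auto simp: image_iff intro!: bexI[of _ A])
  have "B \<in> sets \<eta>" "{0<..\<tau>} \<in> sets \<eta>" "B \<inter> {0<..\<tau>} \<in> sets \<eta>" using B by (auto intro!: 1)
  then show ?thesis unfolding restr_def
    by (simp add: emeasure_density nn_integral_indicator flip: indicator_inter_arith)
      (simp add: Int_commute)
qed

lemma restr_point_measure:
  assumes \<eta>: "\<eta> \<in> point_measures {0<..}" shows "restr \<tau> \<eta> \<in> point_measures {0<..}"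
proof -
  obtain I :: "nat set" and x where eq: "\<eta> = dirac_sum {0<..} I x"
    using \<eta> by (auto simp: point_measures_def)
  have s: "sets (restr \<tau> \<eta>) = sets (restrict_space borel {0<..})"
    using sets_point_measure[OF \<eta>] by (simp add: restr_def)
  have "restr \<tau> \<eta> = dirac_sum {0<..} {i \<in> I. x i \<le> \<tau>} x"
  proof (rule measure_eqI)
    fix B assume "B \<in> sets (restr \<tau> \<eta>)"
    then have B: "B \<in> sets borel" "B \<subseteq> {0<..}" unfolding s by (auto simp: sets_restrict_space)
    have "emeasure (restr \<tau> \<eta>) B = emeasure \<eta> (B \<inter> {0<..\<tau>})"
      by (rule emeasure_restr[OF sets_point_measure[OF \<eta>] B])
    also have "\<dots> = emeasure (count_space I) {i \<in> I. x i \<in> B \<inter> {0<..\<tau>}}"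
      unfolding eq using B by (intro emeasure_dirac_sum) auto
    also have "{i \<in> I. x i \<in> B \<inter> {0<..\<tau>}} = {i \<in> {i \<in> I. x i \<le> \<tau>}. x i \<in> B}" using B by auto
    also have "emeasure (count_space I) \<dots> = emeasure (count_space {i \<in> I. x i \<le> \<tau>}) \<dots>"
      by (subst (1 2) emeasure_count_space) auto
    also have "\<dots> = emeasure (dirac_sum {0<..} {i \<in> I. x i \<le> \<tau>} x) B"
      by (rule emeasure_dirac_sum[OF B, symmetric])
    finally show "emeasure (restr \<tau> \<eta>) B = emeasure (dirac_sum {0<..} {i \<in> I. x i \<le> \<tau>} x) B" .
  qed (simp add: s)
  moreover have "locally_finite {0<..} (restr \<tau> \<eta>)"
    unfolding locally_finite_def
  proof (intro allI impI, elim conjE)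
    fix K :: "real set" assume K: "compact K" "K \<subseteq> {0<..}"
    then have Kb: "K \<in> sets borel" by (simp add: compact_imp_closed)
    have "emeasure (restr \<tau> \<eta>) K = emeasure \<eta> (K \<inter> {0<..\<tau>})"
      by (rule emeasure_restr[OF sets_point_measure[OF \<eta>] Kb K(2)])
    also have "\<dots> < \<infinity>" using emeasure_point_measure_finite[OF \<eta> K _ Kb] by auto
    finally show "emeasure (restr \<tau> \<eta>) K < \<infinity>" .
  qed
  ultimately show ?thesis by (auto simp: point_measures_def)
qed

text \<open>Restriction to \<open>(0,\<tau>]\<close> deletes whole cells, because \<open>\<tau>\<close> is a grid point on every level.\<close>

lemma dyadic_counts_restr:
  assumes \<tau>: "0 < \<tau>" and \<eta>: "\<eta> \<in> point_measures {0<..}"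
  shows "dyadic_counts \<tau> n {1..<4 ^ n} (restr \<tau> \<eta>) = dyadic_counts \<tau> n {1..<2 ^ n} \<eta>"
proof -
  have eq: "cnt (restr \<tau> \<eta>) (cell \<tau> n k) = (if k < 2 ^ n then cnt \<eta> (cell \<tau> n k) else 0)" for k
  proof -
    have "emeasure (restr \<tau> \<eta>) (cell \<tau> n k) = emeasure \<eta> (cell \<tau> n k \<inter> {0<..\<tau>})"
      by (rule emeasure_restr[OF sets_point_measure[OF \<eta>] _ cell_pos[OF \<tau>]]) simp
    moreover have "cell \<tau> n k \<inter> {0<..\<tau>} = (if k < 2 ^ n then cell \<tau> n k else {})"
    proof (cases "k < 2 ^ n")
      case True
      then have "real (Suc k) \<le> real (2 ^ n)" by (simp only: of_nat_le_iff)
      then have "\<tau> * (real k + 1) \<le> \<tau> * 2 ^ n" using \<tau> by (intro mult_left_mono) auto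
      then have "\<tau> * (real k + 1) / 2 ^ n \<le> \<tau>" by (simp add: pos_divide_le_eq)
      then show ?thesis using True cell_pos[OF \<tau>, of n k] by (auto simp: cell_def)
    next
      case False
      then have "real (2 ^ n) \<le> real k" by (simp only: of_nat_le_iff)
      then have "\<tau> * 2 ^ n \<le> \<tau> * real k" using \<tau> by (intro mult_left_mono) auto
      then have "\<tau> \<le> \<tau> * real k / 2 ^ n" by (simp add: pos_le_divide_eq)
      then show ?thesis using False by (auto simp: cell_def)
    qed
    ultimately show ?thesis by (simp add: cnt_def measure_def)
  qed
  have "(2::nat) ^ n \<le> 4 ^ n" by (rule power_mono) auto
  then show ?thesis
    unfolding dyadic_counts_def by (intro multiset_eqI) (auto simp: count_config eq)
qed

lemma measurable_restr:
  assumes \<tau>: "0 < \<tau>"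
  shows "restr \<tau> \<in> vague_borel {0<..} \<rightarrow>\<^sub>M vague_borel {0<..}"
proof (rule measurable_sigma_sets[OF sets_vague_borel_count_events[OF \<tau>]])
  show "count_events \<tau> \<subseteq> Pow (point_measures {0<..})" by (auto simp: count_events_def)
  show "restr \<tau> \<in> space (vague_borel {0<..}) \<rightarrow> point_measures {0<..}"
    by (auto intro: restr_point_measure)
  fix A assume "A \<in> count_events \<tau>"
  then obtain n C where A: "A = {\<eta> \<in> point_measures {0<..}. dyadic_counts \<tau> n {1..<4 ^ n} \<eta> \<in> C}"
    by (auto simp: count_events_def)
  have "restr \<tau> -` A \<inter> space (vague_borel {0<..}) =
      dyadic_counts \<tau> n {1..<2 ^ n} -` C \<inter> space (vague_borel {0<..})"
    unfolding A using dyadic_counts_restr[OF \<tau>] restr_point_measure by auto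
  also have "\<dots> \<in> sets (vague_borel {0<..})"
    using measurable_dyadic_counts[OF \<tau>, of "{1..<2 ^ n}" n] by (rule measurable_sets) auto
  finally show "restr \<tau> -` A \<inter> space (vague_borel {0<..}) \<in> sets (vague_borel {0<..})" .
qed

section \<open>Comparison given the points\<close>

lemma poisson_process_dyadic_counts:
  assumes \<tau>: "0 < \<tau>" and J: "finite J" "0 \<notin> J" and P: "poisson_process_law {0<..} \<mu> P"
  shows "rv_pmf P (dyadic_counts \<tau> n J) = poisson_config J (\<lambda>k. measure \<mu> (cell \<tau> n k))"
proof (rule pmf_eqI)
  fix m
  have pP: "prob_space P" and sP: "sets P = sets (vague_borel {0<..})"
    using P by (auto simp: poisson_process_law_def)
  interpret prob_space P by (rule pP)
  have spP: "space P = point_measures {0<..}" using sets_eq_imp_space_eq[OF sP] by simp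
  have J1: "1 \<le> k" if "k \<in> J" for k using that J(2) by (cases k) auto
  have cells: "finite J \<and> disjoint_family_on (cell \<tau> n) J \<and>
        (\<forall>j\<in>J. cell \<tau> n j \<in> sets borel \<and> (\<exists>K. compact K \<and> K \<subseteq> {0<..} \<and> cell \<tau> n j \<subseteq> K))"
    using J(1) disjoint_family_on_cell[OF \<tau>] cell_relcompact[OF \<tau> J1] by simp
  have ind: "indep_vars (\<lambda>_. borel) (\<lambda>k \<eta>. emeasure \<eta> (cell \<tau> n k)) J"
    and pois: "\<And>k i. k \<in> J \<Longrightarrow> prob {\<eta> \<in> space P. emeasure \<eta> (cell \<tau> n k) = of_nat i} =
           measure \<mu> (cell \<tau> n k) ^ i / fact i * exp (- measure \<mu> (cell \<tau> n k))"
    using P cells unfolding poisson_process_law_def by blast+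
  have meas: "dyadic_counts \<tau> n J \<in> P \<rightarrow>\<^sub>M count_space UNIV"
    using measurable_dyadic_counts[OF \<tau> J] by (simp add: measurable_cong_sets[OF sP refl])
  show "pmf (rv_pmf P (dyadic_counts \<tau> n J)) m = pmf (poisson_config J (\<lambda>k. measure \<mu> (cell \<tau> n k))) m"
  proof (cases "set_mset m \<subseteq> J")
    case False
    then have "{\<eta> \<in> space P. dyadic_counts \<tau> n J \<eta> = m} = {}"
      unfolding dyadic_counts_def using set_mset_config[OF J(1)] by auto
    then have "prob {\<eta> \<in> space P. dyadic_counts \<tau> n J \<eta> = m} = 0" by (simp only: measure_empty)
    then show ?thesis using False
      by (simp add: pmf_rv_pmf[OF pP meas] pmf_poisson_config[OF J(1)])
  next
    case True
    have "prob {\<eta> \<in> space P. dyadic_counts \<tau> n J \<eta> = m} =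
       (\<Prod>k\<in>J. prob {\<eta> \<in> space P. emeasure \<eta> (cell \<tau> n k) = of_nat (count m k)})"
    proof (cases "J = {}")
      case True
      then show ?thesis using \<open>set_mset m \<subseteq> J\<close> by (simp add: dyadic_counts_def config_def prob_space)
    next
      case False
      have "{\<eta> \<in> space P. dyadic_counts \<tau> n J \<eta> = m} =
          (\<Inter>k\<in>J. (\<lambda>\<eta>. emeasure \<eta> (cell \<tau> n k)) -` {of_nat (count m k)} \<inter> space P)"
        using True False cell_measure(3)[OF _ \<tau> J1]
        by (auto simp: dyadic_counts_def config_eq_iff[OF J(1)] spP)
      also have "prob \<dots> = (\<Prod>k\<in>J. prob ((\<lambda>\<eta>. emeasure \<eta> (cell \<tau> n k)) -` {of_nat (count m k)} \<inter> space P))"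
        by (rule indep_varsD_finite[OF ind False J(1)]) simp
      also have "\<dots> = (\<Prod>k\<in>J. prob {\<eta> \<in> space P. emeasure \<eta> (cell \<tau> n k) = of_nat (count m k)})"
        by (intro prod.cong refl arg_cong[where f = prob]) auto
      finally show ?thesis .
    qed
    also have "\<dots> = (\<Prod>k\<in>J. pmf (poisson0 (measure \<mu> (cell \<tau> n k))) (count m k))"
      by (intro prod.cong refl) (simp add: pois pmf_poisson0)
    finally show ?thesis using True
      by (simp add: pmf_rv_pmf[OF pP meas] pmf_poisson_config[OF J(1)])
  qed
qed

text \<open>The configuration of a single point at \<open>z\<close>.\<close>

definition label :: "real \<Rightarrow> nat \<Rightarrow> nat set \<Rightarrow> real \<Rightarrow> nat multiset" where
  "label \<tau> n J z = config J (\<lambda>k. of_bool (z \<in> cell \<tau> n k))"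

lemma label_eq_single_iff:
  assumes \<tau>: "0 < \<tau>" and J: "finite J" and k: "k \<in> J"
  shows "label \<tau> n J z = {#k#} \<longleftrightarrow> z \<in> cell \<tau> n k"
  unfolding label_def config_eq_iff[OF J] using k cell_disjoint[OF \<tau>, of z n] by auto

lemma label_cases:
  assumes \<tau>: "0 < \<tau>" and J: "finite J"
  shows "label \<tau> n J z \<in> insert {#} ((\<lambda>k. {#k#}) ` J)"
proof (cases "\<exists>k\<in>J. z \<in> cell \<tau> n k")
  case True
  then show ?thesis using label_eq_single_iff[OF \<tau> J] by blast
next
  case False
  then have "label \<tau> n J z = {#}" unfolding label_def config_eq_iff[OF J] by auto
  then show ?thesis by simp
qed

lemma measurable_label:
  assumes "finite J" shows "label \<tau> n J \<in> borel \<rightarrow>\<^sub>M count_space UNIV"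
  unfolding label_def
proof (rule measurable_config[OF assms])
  fix k
  have "Measurable.pred borel (\<lambda>z. z \<in> cell \<tau> n k)" by (rule pred_sets2[OF cell_borel]) simp
  then show "(\<lambda>z. of_bool (z \<in> cell \<tau> n k) :: nat) \<in> borel \<rightarrow>\<^sub>M count_space UNIV"
    by (rule measurable_compose) simp
qed

text \<open>Only finitely many points lie in the counted cells, so the partial sums of the labels become
constant.\<close>

lemma dyadic_counts_dirac_sum:
  fixes I :: "nat set"
  assumes \<tau>: "0 < \<tau>" and J: "finite J" "0 \<notin> J" and \<eta>: "dirac_sum {0<..} I z \<in> point_measures {0<..}"
  shows "\<forall>\<^sub>F m in sequentially. dyadic_counts \<tau> n J (dirac_sum {0<..} I z) =
     (\<Sum>i<m. if i \<in> I then label \<tau> n J (z i) else {#})"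
proof -
  let ?F = "\<lambda>k. {i \<in> I. z i \<in> cell \<tau> n k}"
  have J1: "1 \<le> k" if "k \<in> J" for k using that J(2) by (cases k) auto
  have F: "finite (?F k)" "cnt (dirac_sum {0<..} I z) (cell \<tau> n k) = card (?F k)" if "k \<in> J" for k
    by (rule dirac_sum_card[OF cell_borel cell_pos[OF \<tau>] cell_measure(1)[OF \<eta> \<tau> J1[OF that]]])+
  have "finite (\<Union>k\<in>J. ?F k)" using F J by auto
  then obtain m0 where m0: "(\<Union>k\<in>J. ?F k) \<subseteq> {..<m0}" using finite_nat_bounded by blast
  show ?thesis
  proof (rule eventually_sequentiallyI[of m0])
    fix m assume m: "m0 \<le> m"
    show "dyadic_counts \<tau> n J (dirac_sum {0<..} I z) = (\<Sum>i<m. if i \<in> I then label \<tau> n J (z i) else {#})"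
    proof (rule multiset_eqI)
      fix k
      show "count (dyadic_counts \<tau> n J (dirac_sum {0<..} I z)) k =
          count (\<Sum>i<m. if i \<in> I then label \<tau> n J (z i) else {#}) k"
      proof (cases "k \<in> J")
        case True
        have "count (\<Sum>i<m. if i \<in> I then label \<tau> n J (z i) else {#}) k =
            (\<Sum>i<m. if i \<in> ?F k then 1 else 0)"
          unfolding count_sum using True J(1) by (intro sum.cong refl) (auto simp: label_def count_config)
        also have "\<dots> = card ({..<m} \<inter> ?F k)" by (subst sum.inter_restrict[symmetric]) auto
        also have "{..<m} \<inter> ?F k = ?F k" using m0 m True by fastforce
        finally show ?thesis using True J(1) F by (simp add: dyadic_counts_def count_config)
      next
        case False
        have "count (\<Sum>i<m. if i \<in> I then label \<tau> n J (z i) else {#}) k = 0"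
          unfolding count_sum using False J(1) by (intro sum.neutral) (auto simp: label_def count_config)
        then show ?thesis using False J(1) by (simp add: dyadic_counts_def count_config)
      qed
    qed
  qed
qed

lemma nn_integral_dirac_sum:
  fixes I :: "nat set" and f :: "'a::topological_space \<Rightarrow> ennreal"
  assumes f: "f \<in> borel_measurable (restrict_space borel E)" and x: "\<And>i. i \<in> I \<Longrightarrow> x i \<in> E"
  shows "(\<integral>\<^sup>+y. f y \<partial>dirac_sum E I x) = (\<Sum>i. if i \<in> I then f (x i) else 0)"
proof -
  have I: "{i \<in> I. x i \<in> E} = I" using x by auto
  have "(\<integral>\<^sup>+y. f y \<partial>dirac_sum E I x) = (\<integral>\<^sup>+i. f (x i) \<partial>count_space I)"
    unfolding dirac_sum_def I using f x
    by (intro nn_integral_distr) (auto simp: space_restrict_space)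
  also have "\<dots> = (\<integral>\<^sup>+i. (if i \<in> I then f (x i) else 0) \<partial>count_space UNIV)"
    by (subst nn_integral_count_space_eq[of I UNIV "\<lambda>i. if i \<in> I then f (x i) else 0", symmetric])
       (auto intro!: nn_integral_cong)
  finally show ?thesis by (simp add: nn_integral_count_space_nat)
qed

lemma measurable_prob_quotient:
  fixes g :: "'a::topological_space \<Rightarrow> real"
  assumes M: "prob_space M" and S: "S \<in> borel_measurable M" and g: "g \<in> borel_measurable borel"
    and B: "B \<in> sets borel"
  shows "(\<lambda>x. emeasure M {\<omega> \<in> space M. g x / S \<omega> \<in> B}) \<in> borel_measurable borel"
proof -
  interpret prob_space M by fact
  have "(\<lambda>z. g (fst z) / S (snd z)) \<in> borel_measurable (borel \<Otimes>\<^sub>M M)" using g S by measurable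
  from measurable_sets[OF this B]
  have Q: "(\<lambda>z. g (fst z) / S (snd z)) -` B \<inter> space (borel \<Otimes>\<^sub>M M) \<in> sets (borel \<Otimes>\<^sub>M M)" .
  have "(\<lambda>x. emeasure M (Pair x -` ((\<lambda>z. g (fst z) / S (snd z)) -` B \<inter> space (borel \<Otimes>\<^sub>M M)))) \<in> borel_measurable borel"
    by (rule measurable_emeasure_Pair[OF Q])
  then show ?thesis
    by (rule measurable_cong[THEN iffD1, rotated])
      (auto simp: space_pair_measure intro!: arg_cong[where f = "emeasure M"])
qed

lemma sets_mean_measure: "sets (mean_measure M S g \<xi>) = sets (restrict_space borel {0<..})"
  using sets.sigma_sets_eq[of "restrict_space borel {0::real<..}"]
    sets.space_closed[of "restrict_space borel {0::real<..}"]
  by (simp add: mean_measure_def space_restrict_space)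

text \<open>The comparison for a fixed realisation of the points \<open>x i\<close>; \<open>P\<close> is the law of the Poisson process with
the corresponding mean measure.  The count law of \<open>P\<close> contains the intensity of all points, while
only the first \<open>m\<close> labels are summed; the difference \<open>rest m\<close> in intensity tends to 0 as the series
for the mean measure of each cell converges.  Passing to the limit superior here spares the later
integration over the points any handling of \<open>rest m\<close>.\<close>

lemma quenched_counts_limsup:
  fixes g :: "'a::topological_space \<Rightarrow> real" and I :: "nat set"
  assumes M: "prob_space M" and \<tau>: "0 < \<tau>"
    and g: "g \<in> borel_measurable borel" and S: "S \<in> borel_measurable M"
    and T: "prob_space.indep_vars M (\<lambda>_. borel) T UNIV"
    and distr: "\<And>i. distr M borel (T i) = distr M borel S"
    and x: "\<And>i. i \<in> I \<Longrightarrow> x i \<in> E"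
    and P: "poisson_process_law {0<..} (mean_measure M S g (dirac_sum E I x)) P"
  shows "limsup (\<lambda>m. ennreal \<bar>measure M {\<omega> \<in> space M.
        (\<Sum>i<m. if i \<in> I then label \<tau> n {1..<2 ^ n} (g (x i) / T i \<omega>) else {#}) \<in> C} -
      measure P {\<eta> \<in> space P. dyadic_counts \<tau> n {1..<2 ^ n} \<eta> \<in> C}\<bar>)
    \<le> (\<integral>\<^sup>+y. ennreal ((p_fun M S g y \<tau>)\<^sup>2) \<partial>dirac_sum E I x)"
proof -
  interpret prob_space M by fact
  let ?J = "{1..<2 ^ n} :: nat set" and ?\<xi> = "dirac_sum E I x"
  let ?\<mu> = "mean_measure M S g ?\<xi>"
  define W where "W i \<omega> = (if i \<in> I then label \<tau> n ?J (g (x i) / T i \<omega>) else {#})" for i \<omega>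
  define r where "r i k = prob {\<omega> \<in> space M. W i \<omega> = {#k#}}" for i k
  define t where "t k = measure ?\<mu> (cell \<tau> n k)" for k
  have Tm: "T i \<in> borel_measurable M" for i using T by (auto simp: indep_vars_def)
  have J1: "1 \<le> k" if "k \<in> ?J" for k using that by auto
  have pP: "prob_space P" and sP: "sets P = sets (vague_borel {0<..})"
    and lf: "locally_finite {0<..} ?\<mu>"
    using P by (auto simp: poisson_process_law_def)
  have W: "W i \<omega> \<in> insert {#} ((\<lambda>k. {#k#}) ` ?J)" for i \<omega>
    using label_cases[OF \<tau>, of ?J] by (simp add: W_def)
  have indW: "indep_vars (\<lambda>_. count_space UNIV) W UNIV"
  proof -
    have "indep_vars (\<lambda>_. count_space UNIV)
        (\<lambda>i \<omega>. (\<lambda>s. if i \<in> I then label \<tau> n ?J (g (x i) / s) else {#}) (T i \<omega>)) UNIV"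
    proof (rule indep_vars_compose2[OF T])
      fix i
      have "(\<lambda>s. label \<tau> n ?J (g (x i) / s)) \<in> borel \<rightarrow>\<^sub>M count_space UNIV"
        by (rule measurable_compose[OF _ measurable_label]) auto
      then show "(\<lambda>s. if i \<in> I then label \<tau> n ?J (g (x i) / s) else {#}) \<in> borel \<rightarrow>\<^sub>M count_space UNIV"
        by (cases "i \<in> I") (simp_all only: if_True if_False measurable_const space_count_space UNIV_I)
    qed
    then show ?thesis by (simp add: W_def[abs_def])
  qed
  have Wm: "(\<lambda>\<omega>. \<Sum>i<m. W i \<omega>) \<in> M \<rightarrow>\<^sub>M count_space UNIV" for m
    using indW by (intro measurable_sum_count_space) (auto simp: indep_vars_def)
  \<comment> \<open>The labels are built from \<open>T i\<close>, the mean measure from \<open>S\<close>.\<close>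
  have same: "prob {\<omega> \<in> space M. y / T i \<omega> \<in> B} = prob {\<omega> \<in> space M. y / S \<omega> \<in> B}"
    if B: "B \<in> sets borel" for y B i
  proof -
    have V: "(\<lambda>s. y / s) -` B \<in> sets (borel :: real measure)"
      using measurable_sets[OF _ B, of "\<lambda>s. y / s" borel] by simp
    have "prob {\<omega> \<in> space M. y / T i \<omega> \<in> B} = measure (distr M borel (T i)) ((\<lambda>s. y / s) -` B)"
      using V Tm by (subst measure_distr) (auto intro!: arg_cong[where f = prob])
    also have "\<dots> = prob {\<omega> \<in> space M. y / S \<omega> \<in> B}"
      unfolding distr using V S by (subst measure_distr) (auto intro!: arg_cong[where f = prob])
    finally show ?thesis .
  qed
  have Sev: "{\<omega> \<in> space M. y / S \<omega> \<in> B} \<in> sets M" if "B \<in> sets borel" for y B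
    using S that by measurable
  have r: "r i k = (if i \<in> I then prob {\<omega> \<in> space M. g (x i) / S \<omega> \<in> cell \<tau> n k} else 0)"
    if "k \<in> ?J" for i k
    using label_eq_single_iff[OF \<tau> _ that] same[OF cell_borel] by (simp add: r_def W_def)
  \<comment> \<open>The cells are disjoint and lie in \<open>(0,\<tau>]\<close>.\<close>
  have rsum: "(\<Sum>k\<in>?J. r i k) \<le> (if i \<in> I then p_fun M S g (x i) \<tau> else 0)" for i
  proof (cases "i \<in> I")
    case True
    have "(\<Sum>k\<in>?J. r i k) = (\<Sum>k\<in>?J. prob {\<omega> \<in> space M. g (x i) / S \<omega> \<in> cell \<tau> n k})"
      using True by (intro sum.cong refl) (simp add: r)
    also have "\<dots> = prob (\<Union>k\<in>?J. {\<omega> \<in> space M. g (x i) / S \<omega> \<in> cell \<tau> n k})"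
      using Sev cell_disjoint[OF \<tau>, of _ n]
      by (intro finite_measure_finite_Union[symmetric]) (auto simp: disjoint_family_on_def)
    also have "\<dots> \<le> p_fun M S g (x i) \<tau>"
      unfolding p_fun_def
    proof (intro finite_measure_mono)
      have "cell \<tau> n k \<subseteq> {0<..\<tau>}" if "k \<in> ?J" for k
      proof
        fix z assume z: "z \<in> cell \<tau> n k"
        have "real (Suc k) \<le> real (2 ^ n)" using that by (subst of_nat_le_iff) auto
        then have "z * 2 ^ n / \<tau> \<le> 2 ^ n" using z unfolding cell_iff[OF \<tau>] by simp
        then have "z \<le> \<tau>" using \<tau> by (simp add: field_simps)
        then show "z \<in> {0<..\<tau>}" using z cell_pos[OF \<tau>] by auto
      qed
      then show "(\<Union>k\<in>?J. {\<omega> \<in> space M. g (x i) / S \<omega> \<in> cell \<tau> n k}) \<subseteq>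
          {\<omega> \<in> space M. 0 < g (x i) / S \<omega> \<and> g (x i) / S \<omega> \<le> \<tau>}" by fastforce
      show "{\<omega> \<in> space M. 0 < g (x i) / S \<omega> \<and> g (x i) / S \<omega> \<le> \<tau>} \<in> events"
        using Sev[of "{0<..\<tau>}"] by simp
    qed
    finally show ?thesis using True by simp
  next
    case False
    then show ?thesis by (simp add: r)
  qed
  have rs: "(\<lambda>i. r i k) sums t k" if k: "k \<in> ?J" for k
  proof -
    obtain K where K: "compact K" "K \<subseteq> {0<..}" "cell \<tau> n k \<subseteq> K" using cell_relcompact[OF \<tau> J1[OF k]] by blast
    have "emeasure ?\<mu> (cell \<tau> n k) = (\<integral>\<^sup>+y. emeasure M {\<omega> \<in> space M. g y / S \<omega> \<in> cell \<tau> n k} \<partial>?\<xi>)"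
      by (rule emeasure_mean_measure[OF M S g sets_dirac_sum cell_borel cell_pos[OF \<tau>]])
    also have "\<dots> = (\<Sum>i. if i \<in> I then emeasure M {\<omega> \<in> space M. g (x i) / S \<omega> \<in> cell \<tau> n k} else 0)"
      by (rule nn_integral_dirac_sum[OF measurable_restrict_space1[OF measurable_prob_quotient[OF M S g cell_borel]] x])
    also have "\<dots> = (\<Sum>i. ennreal (r i k))"
      using k by (intro suminf_cong) (simp add: r emeasure_eq_measure)
    finally have em: "emeasure ?\<mu> (cell \<tau> n k) = (\<Sum>i. ennreal (r i k))" .
    have "emeasure ?\<mu> (cell \<tau> n k) \<le> emeasure ?\<mu> K"
    proof (rule emeasure_mono[OF K(3)])
      show "K \<in> sets ?\<mu>"
        using K(1,2) unfolding sets_mean_measure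
        by (auto simp: sets_restrict_space image_iff compact_imp_closed intro!: bexI[of _ K])
    qed
    also have "\<dots> < \<infinity>" using lf K by (auto simp: locally_finite_def)
    finally have fin: "(\<Sum>i. ennreal (r i k)) < \<infinity>" using em by simp
    have r0: "0 \<le> r i k" for i by (simp add: r_def)
    have sm: "summable (\<lambda>i. r i k)" using fin r0 by (intro summable_suminf_not_top) auto
    have "t k = (\<Sum>i. r i k)"
      unfolding t_def measure_def em using suminf_ennreal2[OF r0 sm] suminf_nonneg[OF sm r0] by simp
    with sm show ?thesis by (simp add: summable_sums)
  qed
  have le_t: "(\<Sum>i<m. r i k) \<le> t k" if "k \<in> ?J" for k m
    using rs[OF that] by (intro sum_le_suminf[THEN order_trans]) (auto simp: sums_iff r_def)
  have Plaw: "rv_pmf P (dyadic_counts \<tau> n ?J) = poisson_config ?J t"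
    unfolding t_def by (rule poisson_process_dyadic_counts[OF \<tau> _ _ P]) auto
  have Pm: "dyadic_counts \<tau> n ?J \<in> P \<rightarrow>\<^sub>M count_space UNIV"
    using measurable_dyadic_counts[OF \<tau>, of ?J n] by (simp add: measurable_cong_sets[OF sP refl])
  let ?R = "\<integral>\<^sup>+y. ennreal ((p_fun M S g y \<tau>)\<^sup>2) \<partial>?\<xi>"
  define rest where "rest m = (\<Sum>k\<in>?J. t k - (\<Sum>i<m. r i k))" for m
  have rest0: "0 \<le> rest m" for m unfolding rest_def using le_t by (intro sum_nonneg) simp
  have sq: "ennreal (\<Sum>i<m. (\<Sum>k\<in>?J. r i k)\<^sup>2) \<le> ?R" for m
  proof -
    have pm: "(\<lambda>y. ennreal ((p_fun M S g y \<tau>)\<^sup>2)) \<in> borel_measurable (restrict_space borel E)"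
    proof (rule measurable_restrict_space1)
      have "(\<lambda>y. emeasure M {\<omega> \<in> space M. g y / S \<omega> \<in> {0<..\<tau>}}) \<in> borel_measurable borel"
        by (rule measurable_prob_quotient[OF M S g]) simp
      then have "(\<lambda>y. enn2real (emeasure M {\<omega> \<in> space M. g y / S \<omega> \<in> {0<..\<tau>}})) \<in> borel_measurable borel"
        by measurable
      then have "(\<lambda>y. p_fun M S g y \<tau>) \<in> borel_measurable borel" by (simp add: p_fun_def[abs_def] measure_def)
      then show "(\<lambda>y. ennreal ((p_fun M S g y \<tau>)\<^sup>2)) \<in> borel_measurable borel" by measurable
    qed
    have "ennreal (\<Sum>i<m. (\<Sum>k\<in>?J. r i k)\<^sup>2) = (\<Sum>i<m. ennreal ((\<Sum>k\<in>?J. r i k)\<^sup>2))" by simp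
    also have "\<dots> \<le> (\<Sum>i<m. if i \<in> I then ennreal ((p_fun M S g (x i) \<tau>)\<^sup>2) else 0)"
    proof (rule sum_mono)
      fix i
      have "(\<Sum>k\<in>?J. r i k)\<^sup>2 \<le> (if i \<in> I then p_fun M S g (x i) \<tau> else 0)\<^sup>2"
        using rsum[of i] by (intro power_mono) (auto simp: r_def intro!: sum_nonneg)
      then show "ennreal ((\<Sum>k\<in>?J. r i k)\<^sup>2) \<le> (if i \<in> I then ennreal ((p_fun M S g (x i) \<tau>)\<^sup>2) else 0)"
        by (cases "i \<in> I") (auto simp: ennreal_le_iff2)
    qed
    also have "\<dots> \<le> (\<Sum>i. if i \<in> I then ennreal ((p_fun M S g (x i) \<tau>)\<^sup>2) else 0)"
      by (rule sum_le_suminf) auto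
    also have "\<dots> = ?R" by (rule nn_integral_dirac_sum[OF pm x, symmetric])
    finally show ?thesis .
  qed
  have bound: "ennreal \<bar>prob {\<omega> \<in> space M. (\<Sum>i<m. W i \<omega>) \<in> C} -
      measure P {\<eta> \<in> space P. dyadic_counts \<tau> n ?J \<eta> \<in> C}\<bar> \<le> ?R + ennreal (rest m)" for m
  proof -
    have "tv_le ((\<Sum>i<m. (\<Sum>k\<in>?J. r i k)\<^sup>2) + rest m) (rv_pmf M (\<lambda>\<omega>. \<Sum>i<m. W i \<omega>)) (poisson_config ?J t)"
      unfolding rest_def r_def
      by (rule tv_sum_labels_poisson_remainder[OF M _ indW W]) (use le_t in \<open>auto simp: r_def\<close>)
    then have "\<bar>prob {\<omega> \<in> space M. (\<Sum>i<m. W i \<omega>) \<in> C} - measure P {\<eta> \<in> space P. dyadic_counts \<tau> n ?J \<eta> \<in> C}\<bar>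
        \<le> (\<Sum>i<m. (\<Sum>k\<in>?J. r i k)\<^sup>2) + rest m"
      unfolding tv_le_def Plaw[symmetric] measure_rv_pmf[OF M Wm] measure_rv_pmf[OF pP Pm] by blast
    then have "ennreal \<bar>prob {\<omega> \<in> space M. (\<Sum>i<m. W i \<omega>) \<in> C} - measure P {\<eta> \<in> space P. dyadic_counts \<tau> n ?J \<eta> \<in> C}\<bar>
        \<le> ennreal ((\<Sum>i<m. (\<Sum>k\<in>?J. r i k)\<^sup>2) + rest m)" by (rule ennreal_leI)
    also have "\<dots> = ennreal (\<Sum>i<m. (\<Sum>k\<in>?J. r i k)\<^sup>2) + ennreal (rest m)"
      using rest0 by (intro ennreal_plus) (auto intro!: sum_nonneg)
    also have "\<dots> \<le> ?R + ennreal (rest m)" by (intro add_right_mono sq)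
    finally show ?thesis .
  qed
  have "rest \<longlonglongrightarrow> (\<Sum>k\<in>?J. t k - t k)"
    unfolding rest_def using rs by (intro tendsto_intros) (auto simp: sums_def)
  then have "(\<lambda>m. ennreal (rest m)) \<longlonglongrightarrow> ennreal 0" by (intro tendsto_ennrealI) simp
  then have "(\<lambda>m. ?R + ennreal (rest m)) \<longlonglongrightarrow> ?R + ennreal 0" by (intro tendsto_add tendsto_const)
  then have lim: "limsup (\<lambda>m. ?R + ennreal (rest m)) = ?R" by (intro lim_imp_Limsup) auto
  have "limsup (\<lambda>m. ennreal \<bar>prob {\<omega> \<in> space M. (\<Sum>i<m. W i \<omega>) \<in> C} -
      measure P {\<eta> \<in> space P. dyadic_counts \<tau> n ?J \<eta> \<in> C}\<bar>) \<le> limsup (\<lambda>m. ?R + ennreal (rest m))"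
    using bound by (intro Limsup_mono) auto
  then show ?thesis unfolding lim W_def .
qed

section \<open>Averaging over the points\<close>

text \<open>Independence makes the joint law a product measure, so one of the two elements can be averaged while
the other one is kept fixed.\<close>

lemma indep_elements_Fubini:
  assumes M: "prob_space M" and ind: "indep_elements M A X B Y" and Q: "Q \<in> sets (A \<Otimes>\<^sub>M B)"
  shows "emeasure M {\<omega> \<in> space M. (X \<omega>, Y \<omega>) \<in> Q} =
      (\<integral>\<^sup>+\<omega>. emeasure M {\<omega>' \<in> space M. (X \<omega>, Y \<omega>') \<in> Q} \<partial>M)" (is ?eq)
    and "(\<lambda>\<omega>. emeasure M {\<omega>' \<in> space M. (X \<omega>, Y \<omega>') \<in> Q}) \<in> borel_measurable M" (is ?meas)
proof -
  interpret prob_space M by fact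
  have X: "X \<in> M \<rightarrow>\<^sub>M A" and Y: "Y \<in> M \<rightarrow>\<^sub>M B"
    and iset: "indep_set {X -` C \<inter> space M | C. C \<in> sets A} {Y -` D \<inter> space M | D. D \<in> sets B}"
    using ind by (auto simp: indep_elements_def)
  note [measurable] = X Y
  interpret DX: prob_space "distr M A X" by (rule prob_space_distr[OF X])
  interpret DY: prob_space "distr M B Y" by (rule prob_space_distr[OF Y])
  have "distr M A X \<Otimes>\<^sub>M distr M B Y = distr M (A \<Otimes>\<^sub>M B) (\<lambda>\<omega>. (X \<omega>, Y \<omega>))"
  proof (rule pair_measure_eqI)
    fix C D assume "C \<in> sets (distr M A X)" "D \<in> sets (distr M B Y)"
    then have CD: "C \<in> sets A" "D \<in> sets B" by auto
    have "prob ((X -` C \<inter> space M) \<inter> (Y -` D \<inter> space M)) = prob (X -` C \<inter> space M) * prob (Y -` D \<inter> space M)"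
      using CD by (intro indep_setD[OF iset]) auto
    moreover have "(\<lambda>\<omega>. (X \<omega>, Y \<omega>)) -` (C \<times> D) \<inter> space M = (X -` C \<inter> space M) \<inter> (Y -` D \<inter> space M)"
      by auto
    ultimately show "emeasure (distr M A X) C * emeasure (distr M B Y) D =
        emeasure (distr M (A \<Otimes>\<^sub>M B) (\<lambda>\<omega>. (X \<omega>, Y \<omega>))) (C \<times> D)"
      using CD by (simp add: emeasure_distr emeasure_eq_measure ennreal_mult)
  qed (auto intro: DX.sigma_finite_measure_axioms DY.sigma_finite_measure_axioms)
  note joint = this
  have slice: "emeasure (distr M B Y) (Pair x -` Q) = emeasure M {\<omega>' \<in> space M. (x, Y \<omega>') \<in> Q}" for x
    using sets_Pair1[OF Q] by (subst emeasure_distr) (auto intro!: arg_cong[where f = "emeasure M"])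
  have Q': "Q \<in> sets (A \<Otimes>\<^sub>M distr M B Y)" using Q by (simp cong: sets_pair_measure_cong)
  have "(\<lambda>x. emeasure (distr M B Y) (Pair x -` Q)) \<in> borel_measurable A"
    by (rule DY.measurable_emeasure_Pair[OF Q'])
  then have m: "(\<lambda>x. emeasure M {\<omega>' \<in> space M. (x, Y \<omega>') \<in> Q}) \<in> borel_measurable A"
    unfolding slice .
  then show ?meas by (rule measurable_compose[OF X])
  have "emeasure M {\<omega> \<in> space M. (X \<omega>, Y \<omega>) \<in> Q} = emeasure (distr M A X \<Otimes>\<^sub>M distr M B Y) Q"
    unfolding joint using Q by (subst emeasure_distr) (auto intro!: arg_cong[where f = "emeasure M"])
  also have "\<dots> = (\<integral>\<^sup>+x. emeasure M {\<omega>' \<in> space M. (x, Y \<omega>') \<in> Q} \<partial>distr M A X)"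
    using Q by (subst DY.emeasure_pair_measure_alt) (auto simp: slice cong: sets_pair_measure_cong)
  also have "\<dots> = (\<integral>\<^sup>+\<omega>. emeasure M {\<omega>' \<in> space M. (X \<omega>, Y \<omega>') \<in> Q} \<partial>M)"
    using m by (subst nn_integral_distr) auto
  finally show ?eq .
qed

lemma emeasure_cox_process:
  assumes M: "prob_space M" and \<Xi>: "\<Xi> \<in> M \<rightarrow>\<^sub>M A"
    and \<kappa>: "cond_distribution M A \<Xi> B Z \<kappa>" and Z: "Z \<in> M \<rightarrow>\<^sub>M B" and C: "C \<in> sets B"
  shows "emeasure M {\<omega> \<in> space M. Z \<omega> \<in> C} = (\<integral>\<^sup>+\<omega>. emeasure (\<kappa> (\<Xi> \<omega>)) C \<partial>M)"
    and "(\<lambda>\<omega>. emeasure (\<kappa> (\<Xi> \<omega>)) C) \<in> borel_measurable M"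
    and "\<omega> \<in> space M \<Longrightarrow> prob_space (\<kappa> (\<Xi> \<omega>))"
proof -
  have k: "\<kappa> \<in> A \<rightarrow>\<^sub>M prob_algebra B" using \<kappa> by (simp add: cond_distribution_def)
  have m: "(\<lambda>\<xi>. emeasure (\<kappa> \<xi>) C) \<in> borel_measurable A"
    using measurable_emeasure_kernel[OF measurable_prob_algebraD[OF k] C] .
  then show "(\<lambda>\<omega>. emeasure (\<kappa> (\<Xi> \<omega>)) C) \<in> borel_measurable M" by (rule measurable_compose[OF \<Xi>])
  show "\<omega> \<in> space M \<Longrightarrow> prob_space (\<kappa> (\<Xi> \<omega>))"
    using measurable_space[OF k measurable_space[OF \<Xi>]] by (simp add: space_prob_algebra)
  have "emeasure M {\<omega> \<in> space M. Z \<omega> \<in> C} = emeasure M {\<omega> \<in> space M. \<Xi> \<omega> \<in> space A \<and> Z \<omega> \<in> C}"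
    using measurable_space[OF \<Xi>] by (intro arg_cong[where f = "emeasure M"]) auto
  also have "\<dots> = (\<integral>\<^sup>+\<xi>. emeasure (\<kappa> \<xi>) C * indicator (space A) \<xi> \<partial>distr M A \<Xi>)"
    using \<kappa> C by (simp add: cond_distribution_def)
  also have "\<dots> = (\<integral>\<^sup>+\<xi>. emeasure (\<kappa> \<xi>) C \<partial>distr M A \<Xi>)"
    by (intro nn_integral_cong) auto
  also have "\<dots> = (\<integral>\<^sup>+\<omega>. emeasure (\<kappa> (\<Xi> \<omega>)) C \<partial>M)"
    using m by (subst nn_integral_distr[OF \<Xi>]) auto
  finally show "emeasure M {\<omega> \<in> space M. Z \<omega> \<in> C} = (\<integral>\<^sup>+\<omega>. emeasure (\<kappa> (\<Xi> \<omega>)) C \<partial>M)" .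
qed

text \<open>Truncating to the first \<open>m\<close> indices makes the configuration of \<open>N\<close> a measurable function of the points
and the \<open>Si\<close>, to which Fubini's theorem applies.  The truncated configuration agrees with the counts
of \<open>N\<close> for all large \<open>m\<close>, hence its probabilities converge; they are averages of the conditional
probabilities \<open>q m\<close>, which are compared with the conditional probabilities \<open>K\<close> of \<open>Z\<close> in the limit
by the reverse Fatou lemma.\<close>

lemma count_discrepancy_le:
  fixes M :: "'w measure"
    and \<Xi> :: "'w \<Rightarrow> (real ^ 'd) measure"
    and I :: "'w \<Rightarrow> nat set"
    and X :: "nat \<Rightarrow> 'w \<Rightarrow> real ^ 'd"
    and g :: "real ^ 'd \<Rightarrow> real"
    and S :: "'w \<Rightarrow> real"
    and Si :: "nat \<Rightarrow> 'w \<Rightarrow> real"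
    and N Z :: "'w \<Rightarrow> real measure"
    and \<tau> :: real
  assumes M: "prob_space M"
    and \<Xi>: "\<Xi> \<in> M \<rightarrow>\<^sub>M vague_borel (- {0})"
    and \<Xi>_points: "AE \<omega> in M. (\<forall>i\<in>I \<omega>. X i \<omega> \<noteq> 0) \<and> \<Xi> \<omega> = dirac_sum (- {0}) (I \<omega>) (\<lambda>i. X i \<omega>)"
    and g: "g \<in> borel_measurable borel"
    and S_indep: "prob_space.indep_vars M (\<lambda>_. borel) (case_option S Si) UNIV"
    and S_distr: "\<And>i. distr M borel (Si i) = distr M borel S"
    and S_\<Xi>_indep: "indep_of_points M (- {0}) \<Xi> I X (case_option S Si)"
    and N: "N \<in> M \<rightarrow>\<^sub>M vague_borel {0<..}"
    and N_points: "AE \<omega> in M. N \<omega> = dirac_sum {0<..} (I \<omega>) (\<lambda>i. g (X i \<omega>) / Si i \<omega>)"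
    and Z: "cox_process M (- {0}) \<Xi> {0<..} (mean_measure M S g) Z"
    and \<tau>: "0 < \<tau>"
  shows "ennreal \<bar>measure M {\<omega> \<in> space M. dyadic_counts \<tau> n {1..<2 ^ n} (Z \<omega>) \<in> C} -
       measure M {\<omega> \<in> space M. dyadic_counts \<tau> n {1..<2 ^ n} (N \<omega>) \<in> C}\<bar>
    \<le> (\<integral>\<^sup>+\<omega>. (\<integral>\<^sup>+x. ennreal ((p_fun M S g x \<tau>)\<^sup>2) \<partial>\<Xi> \<omega>) \<partial>M)"
proof -
  interpret prob_space M by fact
  let ?J = "{1..<2 ^ n} :: nat set"
  let ?D = "dyadic_counts \<tau> n ?J"
  let ?A = "vague_borel (- {0 :: real ^ 'd}) \<Otimes>\<^sub>M (\<Pi>\<^sub>M i\<in>(UNIV :: nat set). count_space (UNIV :: bool set) \<Otimes>\<^sub>M (borel :: (real ^ 'd) measure))"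
  let ?B = "\<Pi>\<^sub>M k\<in>(UNIV :: nat option set). (borel :: real measure)"
  define c where "c \<omega> = (\<Xi> \<omega>, \<lambda>i. (i \<in> I \<omega>, X i \<omega>))" for \<omega>
  define T where "T \<omega> = (\<lambda>k. case_option S Si k \<omega>)" for \<omega>
  have ind: "indep_elements M ?A c ?B T"
    using S_\<Xi>_indep unfolding indep_of_points_def c_def[abs_def] T_def[abs_def] .
  have Tm: "case_option S Si k \<in> borel_measurable M" for k using S_indep by (auto simp: indep_vars_def)
  have Sm: "S \<in> borel_measurable M" using Tm[of None] by simp
  have Si_ind: "indep_vars (\<lambda>_. borel) Si UNIV"
  proof -
    have "indep_vars (\<lambda>i. PiM {Some i} (\<lambda>_. borel))
        (\<lambda>i \<omega>. restrict (\<lambda>k. case_option S Si k \<omega>) {Some i}) (UNIV :: nat set)"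
      by (rule indep_vars_restrict[OF S_indep]) (auto simp: disjoint_family_on_def)
    then have "indep_vars (\<lambda>_. borel)
        (\<lambda>i \<omega>. (\<lambda>f. f (Some i)) (restrict (\<lambda>k. case_option S Si k \<omega>) {Some i})) (UNIV :: nat set)"
      by (rule indep_vars_compose2) (auto intro: measurable_component_singleton)
    then show ?thesis by simp
  qed
  have Dm: "?D \<in> vague_borel {0<..} \<rightarrow>\<^sub>M count_space UNIV" using measurable_dyadic_counts[OF \<tau>, of ?J n] by simp
  obtain \<kappa> where \<kappa>: "cond_distribution M (vague_borel (- {0})) \<Xi> (vague_borel {0<..}) Z \<kappa>"
    and \<kappa>P: "AE \<omega> in M. poisson_process_law {0<..} (mean_measure M S g (\<Xi> \<omega>)) (\<kappa> (\<Xi> \<omega>))"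
    and Zm: "Z \<in> M \<rightarrow>\<^sub>M vague_borel {0<..}"
    using Z by (auto simp: cox_process_def)
  define Y where "Y = ?D -` C \<inter> space (vague_borel {0<..})"
  have Y: "Y \<in> sets (vague_borel {0<..})" unfolding Y_def using Dm by (rule measurable_sets) simp
  note cox = emeasure_cox_process[OF M \<Xi> \<kappa> Zm Y]
  define K where "K \<omega> = measure (\<kappa> (\<Xi> \<omega>)) Y" for \<omega>
  have Km: "K \<in> borel_measurable M" unfolding K_def measure_def using cox(2) by measurable
  have K01: "0 \<le> K \<omega>" "K \<omega> \<le> 1" if "\<omega> \<in> space M" for \<omega>
    unfolding K_def using prob_space.prob_le_1[OF cox(3)[OF that]] by auto
  have Kint: "integrable M K"
    using K01 by (intro integrable_const_bound[of _ 1] Km AE_I2) auto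
  have EZ: "prob {\<omega> \<in> space M. ?D (Z \<omega>) \<in> C} = (\<integral>\<omega>. K \<omega> \<partial>M)"
  proof -
    have "{\<omega> \<in> space M. ?D (Z \<omega>) \<in> C} = {\<omega> \<in> space M. Z \<omega> \<in> Y}"
      unfolding Y_def using measurable_space[OF Zm] by auto
    then have "emeasure M {\<omega> \<in> space M. ?D (Z \<omega>) \<in> C} = (\<integral>\<^sup>+\<omega>. ennreal (K \<omega>) \<partial>M)"
      unfolding K_def using cox(1) prob_space.finite_measure[OF cox(3)]
      by (auto intro!: nn_integral_cong simp: finite_measure.emeasure_eq_measure)
    also have "\<dots> = ennreal (\<integral>\<omega>. K \<omega> \<partial>M)"
      using Kint K01 by (intro nn_integral_eq_integral AE_I2) auto
    finally show ?thesis
      using K01 by (simp add: emeasure_eq_measure integral_nonneg_AE)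
  qed
  \<comment> \<open>The configuration of the first \<open>m\<close> indices, with the points and the variables \<open>Si\<close> as separate
    arguments.\<close>
  define F :: "nat \<Rightarrow> (real ^ 'd) measure \<times> (nat \<Rightarrow> bool \<times> (real ^ 'd)) \<Rightarrow> (nat option \<Rightarrow> real) \<Rightarrow> nat multiset"
    where "F m a t = (\<Sum>i<m. if fst (snd a i) then label \<tau> n ?J (g (snd (snd a i)) / t (Some i)) else {#})" for m a t
  have F_eq: "F m (c \<omega>) (T \<omega>') =
      (\<Sum>i<m. if i \<in> I \<omega> then label \<tau> n ?J (g (X i \<omega>) / Si i \<omega>') else {#})" for m \<omega> \<omega>'
    unfolding F_def c_def T_def by (simp only: fst_conv snd_conv option.case)
  define Q where "Q m = (\<lambda>(a, t). F m a t) -` C \<inter> space (?A \<Otimes>\<^sub>M ?B)" for m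
  have Q: "Q m \<in> sets (?A \<Otimes>\<^sub>M ?B)" for m
  proof -
    have "(\<lambda>z. F m (fst z) (snd z)) \<in> (?A \<Otimes>\<^sub>M ?B) \<rightarrow>\<^sub>M count_space UNIV"
      unfolding F_def
    proof (rule measurable_sum_count_space)
      fix i
      have comp: "(\<lambda>z. snd (fst z) i) \<in> (?A \<Otimes>\<^sub>M ?B) \<rightarrow>\<^sub>M count_space UNIV \<Otimes>\<^sub>M borel"
        by (rule measurable_compose[OF measurable_compose[OF measurable_fst measurable_snd] measurable_component_singleton[OF UNIV_I]])
      have b: "Measurable.pred (?A \<Otimes>\<^sub>M ?B) (\<lambda>z. fst (snd (fst z) i))"
        using comp by (rule measurable_compose) simp
      have "(\<lambda>z. snd (snd (fst z) i)) \<in> borel_measurable (?A \<Otimes>\<^sub>M ?B)"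
        using comp by (rule measurable_compose) simp
      then have q1: "(\<lambda>z. g (snd (snd (fst z) i))) \<in> borel_measurable (?A \<Otimes>\<^sub>M ?B)"
        using g by (rule measurable_compose)
      have q2: "(\<lambda>z. snd z (Some i)) \<in> borel_measurable (?A \<Otimes>\<^sub>M ?B)"
        by (rule measurable_compose[OF measurable_snd measurable_component_singleton[OF UNIV_I]])
      have "(\<lambda>z. label \<tau> n ?J (g (snd (snd (fst z) i)) / snd z (Some i))) \<in> (?A \<Otimes>\<^sub>M ?B) \<rightarrow>\<^sub>M count_space UNIV"
        by (rule measurable_compose[OF borel_measurable_divide[OF q1 q2] measurable_label]) simp
      then show "(\<lambda>z. if fst (snd (fst z) i) then label \<tau> n ?J (g (snd (snd (fst z) i)) / snd z (Some i)) else {#})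
          \<in> (?A \<Otimes>\<^sub>M ?B) \<rightarrow>\<^sub>M count_space UNIV"
        by (intro measurable_If b) auto
    qed
    from measurable_sets[OF this, of C] show ?thesis unfolding Q_def by (simp add: case_prod_beta')
  qed
  have cm: "c \<in> M \<rightarrow>\<^sub>M ?A" and Tmm: "T \<in> M \<rightarrow>\<^sub>M ?B"
    using ind by (auto simp: indep_elements_def)
  have QF: "(c \<omega>, T \<omega>') \<in> Q m \<longleftrightarrow> F m (c \<omega>) (T \<omega>') \<in> C" if "\<omega> \<in> space M" "\<omega>' \<in> space M" for \<omega> \<omega>' m
    using measurable_space[OF cm that(1)] measurable_space[OF Tmm that(2)]
    unfolding Q_def by (simp add: space_pair_measure)
  define q where "q m \<omega> = prob {\<omega>' \<in> space M. F m (c \<omega>) (T \<omega>') \<in> C}" for m \<omega>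
  have q_eq: "ennreal (q m \<omega>) = emeasure M {\<omega>' \<in> space M. (c \<omega>, T \<omega>') \<in> Q m}" if "\<omega> \<in> space M" for m \<omega>
    unfolding q_def emeasure_eq_measure using QF[OF that] by (auto intro!: arg_cong[where f = prob])
  have qm: "q m \<in> borel_measurable M" for m
  proof -
    have "(\<lambda>\<omega>. ennreal (q m \<omega>)) \<in> borel_measurable M"
      using indep_elements_Fubini(2)[OF M ind Q, of m] by (simp add: q_eq cong: measurable_cong)
    then have "(\<lambda>\<omega>. enn2real (ennreal (q m \<omega>))) \<in> borel_measurable M" by measurable
    then show ?thesis by (simp add: q_def[abs_def])
  qed
  have q01: "0 \<le> q m \<omega>" "q m \<omega> \<le> 1" for m \<omega> by (auto simp: q_def)
  have qint: "integrable M (q m)" for m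
    using q01 by (intro integrable_const_bound[of _ 1] qm AE_I2) auto
  have Fm: "{\<omega> \<in> space M. F m (c \<omega>) (T \<omega>) \<in> C} \<in> events" for m
  proof -
    have "{\<omega> \<in> space M. F m (c \<omega>) (T \<omega>) \<in> C} = (\<lambda>\<omega>. (c \<omega>, T \<omega>)) -` Q m \<inter> space M"
      using QF by (intro set_eqI) (metis (no_types, lifting) Int_iff mem_Collect_eq vimage_eq)
    then show ?thesis using measurable_sets[OF measurable_Pair[OF cm Tmm] Q] by simp
  qed
  have EF: "prob {\<omega> \<in> space M. F m (c \<omega>) (T \<omega>) \<in> C} = (\<integral>\<omega>. q m \<omega> \<partial>M)" for m
  proof -
    have "emeasure M {\<omega> \<in> space M. F m (c \<omega>) (T \<omega>) \<in> C} = emeasure M {\<omega> \<in> space M. (c \<omega>, T \<omega>) \<in> Q m}"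
      using QF by (intro arg_cong[where f = "emeasure M"] Collect_cong) metis
    also have "\<dots> = (\<integral>\<^sup>+\<omega>. ennreal (q m \<omega>) \<partial>M)"
      unfolding indep_elements_Fubini(1)[OF M ind Q] by (intro nn_integral_cong) (simp add: q_eq)
    also have "\<dots> = ennreal (\<integral>\<omega>. q m \<omega> \<partial>M)"
      using qint q01 by (intro nn_integral_eq_integral) auto
    finally show ?thesis using q01 by (simp add: emeasure_eq_measure integral_nonneg_AE)
  qed
  have Dsets: "{\<omega> \<in> space M. ?D (N \<omega>) \<in> C} \<in> events"
    using measurable_sets[OF measurable_compose[OF N Dm], of C] by (simp add: vimage_def Int_def conj_commute)
  have lim: "(\<lambda>m. prob {\<omega> \<in> space M. F m (c \<omega>) (T \<omega>) \<in> C}) \<longlonglongrightarrow> prob {\<omega> \<in> space M. ?D (N \<omega>) \<in> C}"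
  proof -
    let ?i = "\<lambda>A. indicator A :: 'w \<Rightarrow> real"
    have "(\<lambda>m. \<integral>\<omega>. ?i {\<omega> \<in> space M. F m (c \<omega>) (T \<omega>) \<in> C} \<omega> \<partial>M) \<longlonglongrightarrow>
        (\<integral>\<omega>. ?i {\<omega> \<in> space M. ?D (N \<omega>) \<in> C} \<omega> \<partial>M)"
    proof (rule integral_dominated_convergence[where w = "\<lambda>_. 1"])
      show "AE \<omega> in M. (\<lambda>m. ?i {\<omega> \<in> space M. F m (c \<omega>) (T \<omega>) \<in> C} \<omega>) \<longlonglongrightarrow> ?i {\<omega> \<in> space M. ?D (N \<omega>) \<in> C} \<omega>"
        using N_points
      proof eventually_elim
        case (elim \<omega>)
        have "\<forall>\<^sub>F m in sequentially. ?i {\<omega> \<in> space M. F m (c \<omega>) (T \<omega>) \<in> C} \<omega> = ?i {\<omega> \<in> space M. ?D (N \<omega>) \<in> C} \<omega>"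
        proof (cases "\<omega> \<in> space M")
          case True
          then have "N \<omega> \<in> point_measures {0<..}" using measurable_space[OF N] by simp
          then have "\<forall>\<^sub>F m in sequentially. ?D (N \<omega>) =
              (\<Sum>i<m. if i \<in> I \<omega> then label \<tau> n ?J (g (X i \<omega>) / Si i \<omega>) else {#})"
            unfolding elim using \<tau> by (intro dyadic_counts_dirac_sum) auto
          then show ?thesis
            by eventually_elim (simp only: F_eq indicator_def mem_Collect_eq)
        qed simp
        then show ?case by (rule tendsto_eventually)
      qed
    qed (use Fm Dsets in auto)
    then show ?thesis using Fm Dsets by simp
  qed
  let ?R = "\<lambda>\<omega>. \<integral>\<^sup>+x. ennreal ((p_fun M S g x \<tau>)\<^sup>2) \<partial>\<Xi> \<omega>"
  have quenched: "AE \<omega> in M. limsup (\<lambda>m. ennreal \<bar>q m \<omega> - K \<omega>\<bar>) \<le> ?R \<omega>"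
    using \<Xi>_points \<kappa>P
  proof (eventually_elim)
    fix \<omega> assume 1: "(\<forall>i\<in>I \<omega>. X i \<omega> \<noteq> 0) \<and> \<Xi> \<omega> = dirac_sum (- {0}) (I \<omega>) (\<lambda>i. X i \<omega>)"
      and 2: "poisson_process_law {0<..} (mean_measure M S g (\<Xi> \<omega>)) (\<kappa> (\<Xi> \<omega>))"
    have eq: "\<Xi> \<omega> = dirac_sum (- {0}) (I \<omega>) (\<lambda>i. X i \<omega>)" and X: "\<And>i. i \<in> I \<omega> \<Longrightarrow> X i \<omega> \<in> - {0}"
      using 1 by auto
    have "sets (\<kappa> (\<Xi> \<omega>)) = sets (vague_borel {0<..})" using 2 by (simp add: poisson_process_law_def)
    then have sp: "space (\<kappa> (\<Xi> \<omega>)) = point_measures {0<..}" by (simp add: sets_eq_imp_space_eq)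
    have "K \<omega> = measure (\<kappa> (\<Xi> \<omega>)) {\<eta> \<in> space (\<kappa> (\<Xi> \<omega>)). ?D \<eta> \<in> C}"
      unfolding K_def Y_def sp by (intro arg_cong[where f = "measure _"]) auto
    moreover have "q m \<omega> = prob {\<omega>' \<in> space M.
        (\<Sum>i<m. if i \<in> I \<omega> then label \<tau> n ?J (g (X i \<omega>) / Si i \<omega>') else {#}) \<in> C}" for m
      by (simp only: q_def F_eq)
    ultimately show "limsup (\<lambda>m. ennreal \<bar>q m \<omega> - K \<omega>\<bar>) \<le> ?R \<omega>"
      using quenched_counts_limsup[OF M \<tau> g Sm Si_ind S_distr X 2[unfolded eq]] unfolding eq by simp
  qed
  have step: "ennreal \<bar>prob {\<omega> \<in> space M. ?D (Z \<omega>) \<in> C} - prob {\<omega> \<in> space M. F m (c \<omega>) (T \<omega>) \<in> C}\<bar>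
      \<le> (\<integral>\<^sup>+\<omega>. ennreal \<bar>q m \<omega> - K \<omega>\<bar> \<partial>M)" for m
  proof -
    have "\<bar>prob {\<omega> \<in> space M. ?D (Z \<omega>) \<in> C} - prob {\<omega> \<in> space M. F m (c \<omega>) (T \<omega>) \<in> C}\<bar> = \<bar>\<integral>\<omega>. q m \<omega> - K \<omega> \<partial>M\<bar>"
      unfolding EZ EF using Kint qint by simp
    also have "\<dots> \<le> (\<integral>\<omega>. \<bar>q m \<omega> - K \<omega>\<bar> \<partial>M)" by (rule integral_abs_bound)
    finally have "ennreal \<bar>prob {\<omega> \<in> space M. ?D (Z \<omega>) \<in> C} - prob {\<omega> \<in> space M. F m (c \<omega>) (T \<omega>) \<in> C}\<bar>
        \<le> ennreal (\<integral>\<omega>. \<bar>q m \<omega> - K \<omega>\<bar> \<partial>M)" by (rule ennreal_leI)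
    also have "\<dots> = (\<integral>\<^sup>+\<omega>. ennreal \<bar>q m \<omega> - K \<omega>\<bar> \<partial>M)"
      using Kint qint by (intro nn_integral_eq_integral[symmetric]) auto
    finally show ?thesis .
  qed
  have "(\<lambda>m. ennreal \<bar>prob {\<omega> \<in> space M. ?D (Z \<omega>) \<in> C} - prob {\<omega> \<in> space M. F m (c \<omega>) (T \<omega>) \<in> C}\<bar>) \<longlonglongrightarrow>
      ennreal \<bar>prob {\<omega> \<in> space M. ?D (Z \<omega>) \<in> C} - prob {\<omega> \<in> space M. ?D (N \<omega>) \<in> C}\<bar>"
    by (intro tendsto_ennrealI tendsto_intros lim)
  then have "ennreal \<bar>prob {\<omega> \<in> space M. ?D (Z \<omega>) \<in> C} - prob {\<omega> \<in> space M. ?D (N \<omega>) \<in> C}\<bar> =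
      limsup (\<lambda>m. ennreal \<bar>prob {\<omega> \<in> space M. ?D (Z \<omega>) \<in> C} - prob {\<omega> \<in> space M. F m (c \<omega>) (T \<omega>) \<in> C}\<bar>)"
    by (intro lim_imp_Limsup[symmetric]) auto
  also have "\<dots> \<le> limsup (\<lambda>m. \<integral>\<^sup>+\<omega>. ennreal \<bar>q m \<omega> - K \<omega>\<bar> \<partial>M)"
    using step by (intro Limsup_mono) auto
  also have "\<dots> \<le> (\<integral>\<^sup>+\<omega>. limsup (\<lambda>m. ennreal \<bar>q m \<omega> - K \<omega>\<bar>) \<partial>M)"
  proof (rule nn_integral_limsup[where w = "\<lambda>_. 1"])
    show "(\<lambda>\<omega>. ennreal \<bar>q m \<omega> - K \<omega>\<bar>) \<in> borel_measurable M" for m using qm Km by measurable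
    show "AE \<omega> in M. ennreal \<bar>q m \<omega> - K \<omega>\<bar> \<le> 1" for m
    proof (rule AE_I2)
      fix \<omega> assume "\<omega> \<in> space M"
      then have "\<bar>q m \<omega> - K \<omega>\<bar> \<le> 1" using K01[of \<omega>] q01[of m \<omega>] by linarith
      then show "ennreal \<bar>q m \<omega> - K \<omega>\<bar> \<le> 1" by (simp add: ennreal_le_1)
    qed
  qed (auto simp: emeasure_space_1)
  also have "\<dots> \<le> (\<integral>\<^sup>+\<omega>. ?R \<omega> \<partial>M)" by (rule nn_integral_mono_AE[OF quenched])
  finally show ?thesis .
qed

theorem theorem2p8:
  fixes M :: "'w measure"
    and \<Xi> :: "'w \<Rightarrow> (real ^ 'd) measure"
    and I :: "'w \<Rightarrow> nat set"
    and X :: "nat \<Rightarrow> 'w \<Rightarrow> real ^ 'd"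
    and g :: "real ^ 'd \<Rightarrow> real"
    and S :: "'w \<Rightarrow> real"
    and Si :: "nat \<Rightarrow> 'w \<Rightarrow> real"
    and N Z :: "'w \<Rightarrow> real measure"
    and \<tau> :: real
  assumes M: "prob_space M"
    and \<Xi>: "\<Xi> \<in> M \<rightarrow>\<^sub>M vague_borel (- {0})"
    and \<Xi>_points: "AE \<omega> in M. (\<forall>i\<in>I \<omega>. X i \<omega> \<noteq> 0) \<and> \<Xi> \<omega> = dirac_sum (- {0}) (I \<omega>) (\<lambda>i. X i \<omega>)"
    and g: "g \<in> borel_measurable borel" "\<And>x. 0 \<le> g x"
    and g_locally_finite:
      "AE \<omega> in M. locally_finite {0<..} (dirac_sum {0<..} (I \<omega>) (\<lambda>i. g (X i \<omega>)))"
    and S_pos: "AE \<omega> in M. 0 < S \<omega>" "\<And>i. AE \<omega> in M. 0 < Si i \<omega>"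
    and S_indep: "prob_space.indep_vars M (\<lambda>_. borel) (case_option S Si) UNIV"
    and S_distr: "\<And>i. distr M borel (Si i) = distr M borel S"
    and S_\<Xi>_indep: "indep_of_points M (- {0}) \<Xi> I X (case_option S Si)"
    and N: "N \<in> M \<rightarrow>\<^sub>M vague_borel {0<..}"
    and N_points: "AE \<omega> in M. N \<omega> = dirac_sum {0<..} (I \<omega>) (\<lambda>i. g (X i \<omega>) / Si i \<omega>)"
    and Z: "cox_process M (- {0}) \<Xi> {0<..} (mean_measure M S g) Z"
    and \<tau>: "0 < \<tau>"
  shows "ennreal (tv_dist (distr M (vague_borel {0<..}) (\<lambda>\<omega>. restr \<tau> (Z \<omega>)))
                          (distr M (vague_borel {0<..}) (\<lambda>\<omega>. restr \<tau> (N \<omega>))))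
         \<le> (\<integral>\<^sup>+\<omega>. (\<integral>\<^sup>+x. ennreal ((p_fun M S g x \<tau>)\<^sup>2) \<partial>\<Xi> \<omega>) \<partial>M)"
proof (cases "(\<integral>\<^sup>+\<omega>. (\<integral>\<^sup>+x. ennreal ((p_fun M S g x \<tau>)\<^sup>2) \<partial>\<Xi> \<omega>) \<partial>M) = \<infinity>")
  case False
  interpret prob_space M by fact
  let ?R = "\<integral>\<^sup>+\<omega>. (\<integral>\<^sup>+x. ennreal ((p_fun M S g x \<tau>)\<^sup>2) \<partial>\<Xi> \<omega>) \<partial>M" and ?V = "vague_borel {0::real<..}"
  define b where "b = enn2real ?R"
  have b: "?R = ennreal b" using False by (simp add: b_def less_top)
  have b0: "0 \<le> b" by (simp add: b_def)
  have Zm: "Z \<in> M \<rightarrow>\<^sub>M ?V" using Z by (auto simp: cox_process_def)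
  \<comment> \<open>Restricted to \<open>(0,\<tau>]\<close>, a process keeps the counts of the cells \<open>k < 2 ^ n\<close> and loses
    those of the others, so the count events of the restricted processes are those compared above.\<close>
  define P where "P W = distr M ?V (\<lambda>\<omega>. restr \<tau> (W \<omega>))" for W
  have rm: "(\<lambda>\<omega>. restr \<tau> (W \<omega>)) \<in> M \<rightarrow>\<^sub>M ?V" if "W \<in> M \<rightarrow>\<^sub>M ?V" for W
    using that by (rule measurable_compose[OF _ measurable_restr[OF \<tau>]])
  have ev: "measure (P W) {\<eta> \<in> point_measures {0<..}. dyadic_counts \<tau> n {1..<4 ^ n} \<eta> \<in> C} =
      prob {\<omega> \<in> space M. dyadic_counts \<tau> n {1..<2 ^ n} (W \<omega>) \<in> C}" if W: "W \<in> M \<rightarrow>\<^sub>M ?V" for W n C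
  proof -
    let ?E = "{\<eta> \<in> point_measures {0<..}. dyadic_counts \<tau> n {1..<4 ^ n} \<eta> \<in> C}"
    have "?E \<in> count_events \<tau>" by (auto simp: count_events_def)
    then have "?E \<in> sets ?V" unfolding sets_vague_borel_count_events[OF \<tau>] by (rule sigma_sets.Basic)
    then have "measure (P W) ?E = prob ((\<lambda>\<omega>. restr \<tau> (W \<omega>)) -` ?E \<inter> space M)"
      unfolding P_def by (intro measure_distr rm W) auto
    also have "(\<lambda>\<omega>. restr \<tau> (W \<omega>)) -` ?E \<inter> space M = {\<omega> \<in> space M. dyadic_counts \<tau> n {1..<2 ^ n} (W \<omega>) \<in> C}"
    proof -
      have "W \<omega> \<in> point_measures {0<..}" if "\<omega> \<in> space M" for \<omega> using measurable_space[OF W that] by simp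
      then show ?thesis
        using dyadic_counts_restr[OF \<tau>] restr_point_measure
        by (intro set_eqI) (metis (no_types, lifting) Int_iff mem_Collect_eq vimage_eq)
    qed
    finally show ?thesis .
  qed
  have le: "\<bar>measure (P Z) A - measure (P N) A\<bar> \<le> b" if A: "A \<in> sets ?V" for A
  proof (rule total_variation_le_from_generating_algebra[OF algebra_count_events[OF \<tau>]])
    show "finite_measure (P Z)" "finite_measure (P N)"
      unfolding P_def using prob_space_distr[OF rm[OF Zm]] prob_space_distr[OF rm[OF N]]
      by (simp_all add: prob_space_def)
    show "sets (P Z) = sigma_sets (point_measures {0<..}) (count_events \<tau>)"
      "sets (P N) = sigma_sets (point_measures {0<..}) (count_events \<tau>)"
      by (simp_all add: P_def sets_vague_borel_count_events[OF \<tau>])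
    show "A \<in> sigma_sets (point_measures {0<..}) (count_events \<tau>)"
      using A by (simp add: sets_vague_borel_count_events[OF \<tau>])
    fix A assume "A \<in> count_events \<tau>"
    then obtain n C where A: "A = {\<eta> \<in> point_measures {0<..}. dyadic_counts \<tau> n {1..<4 ^ n} \<eta> \<in> C}"
      by (auto simp only: count_events_def mem_Collect_eq)
    have "ennreal \<bar>measure (P Z) A - measure (P N) A\<bar> \<le> ?R"
      unfolding A ev[OF Zm] ev[OF N]
      by (rule count_discrepancy_le[OF M \<Xi> \<Xi>_points g(1) S_indep S_distr S_\<Xi>_indep N N_points Z \<tau>])
    then show "\<bar>measure (P Z) A - measure (P N) A\<bar> \<le> b" unfolding b using b0 by (simp add: ennreal_le_iff)
  qed
  have "tv_dist (P Z) (P N) \<le> b"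
    unfolding tv_dist_def
  proof (rule cSUP_least)
    show "sets (P Z) \<noteq> {}" using sets.top[of "P Z"] by blast
    show "\<bar>measure (P Z) A - measure (P N) A\<bar> \<le> b" if "A \<in> sets (P Z)" for A
      using that le by (simp add: P_def)
  qed
  then show ?thesis unfolding b P_def by (rule ennreal_leI)
qed simp

end
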